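(* Let $k$ be a field, let $R=k[x_1,\ldots,x_n]$, and let $\Delta$ be a $(d-1)$-dimensional simplicial complex on the vertex set $[n]=\{1,\ldots,n\}$. Suppose that the Stanley--Reisner ring $k[\Delta]$ has a pure free resolution $$0\longrightarrow R(-d_p)^{\beta_p}\longrightarrow\cdots\longrightarrow R(-d_1)^{\beta_1}\longrightarrow R(-d_0)^{\beta_0}\longrightarrow R\longrightarrow k[\Delta]\longrightarrow 0 .$$ If $h(\Delta)=(h_0(\Delta),\ldots,h_d(\Delta))$ is the $h$-vector of $\Delta$ (with $h_j:=h_j(\Delta)$ for $0\le j\le d$ and $h_j:=0$ for $j>d$), then $$\beta_i=\sum_{\ell=0}^{d_i}(-1)^{\ell+i+1}\binom{n-d}{\ell}h_{d_i-\ell}$$ for each $0\le i\le p$.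
   Context: Let $k$ be an arbitrary field and $R=k[x_1,\ldots,x_n]$ with the standard grading; $R(-j)$ denotes the free graded $R$-module obtained by shifting the degrees of $R$ by $j$ (generator in degree $j$). A simplicial complex on $[n]=\{1,\ldots,n\}$ is a set $\Delta$ of subsets of $[n]$, closed under taking subsets, with $\{i\}\in\Delta$ for all $i\in[n]$. Its elements are called faces; the dimension of a face is its cardinality minus one, and $\dim(\Delta)$ is the maximal dimension of a face. If $\dim(\Delta)=d-1$, then $f_i=f_i(\Delta)$ denotes the number of $i$-dimensional faces for $-1\le i\le d-1$ (so $f_{-1}=1$), and the $h$-vector $(h_0(\Delta),\ldots,h_d(\Delta))$ is defined by $H_{k[\Delta]}(z)=\frac{\sum_{i=0}^d h_i(\Delta)z^i}{(1-z)^d}$, where $H_{k[\Delta]}(z)=\sum_{s\ge 0}\dim_k(k[\Delta]_s)z^s$ is the Hilbert series; equivalently $h_j(\Delta)=\sum_{i=0}^j(-1)^{j-i}\binom{d-i}{j-i}f_{i-1}$ for $0\le j\le d$. The Stanley--Reisner ring is $k[\Delta]=R/I(\Delta)$, where $I(\Delta)=\langle x^F: F\subseteq[n],\ F\notin\Delta\rangle$ and $x^F=\prod_{i\in F}x_i$. A pure free resolution is a minimal graded free resolution in which each free module is generated in a single degree, these degrees being strictly increasing along the resolution. In the displayed resolution this means $0<d_0<d_1<\cdots<d_p$; here $p\ge 0$, the resolution is minimal, and the $\beta_i$ are positive integers. Thus $\beta_i$ is the rank of the free module in homological position $i+1$ of the resolution of $k[\Delta]$. Convention: $\binom{m}{\ell}=0$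 for $\ell>m\geq 0$. *)

theory Defs
  imports
    "HOL-Algebra.QuotRing"
    "HOL-Library.Poly_Mapping"
    "HOL-Computational_Algebra.Formal_Power_Series"
    "Jordan_Normal_Form.VS_Connect"
begin

hide_const (open) Multiset.mult Polynomial.smult

section \<open>The polynomial ring\<close>

text \<open>
  A polynomial in the variables \<open>x\<^sub>i\<close> (\<open>i :: nat\<close>) is a finitely supported map from exponent vectors
  to coefficients, with the convolution product of \<open>Poly_Mapping\<close>; \<open>poly_ring n\<close> is the subring
  \<open>k[x\<^sub>1,\<dots>,x\<^sub>n]\<close>.
\<close>

type_synonym 'k mpol = "(nat \<Rightarrow>\<^sub>0 nat) \<Rightarrow>\<^sub>0 'k"

definition mon_deg :: "(nat \<Rightarrow>\<^sub>0 nat) \<Rightarrow> nat" where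
  "mon_deg m = (\<Sum>i\<in>Poly_Mapping.keys m. Poly_Mapping.lookup m i)"

definition const :: "'k::zero \<Rightarrow> 'k mpol" where
  "const c = Poly_Mapping.single 0 c"

definition var :: "nat \<Rightarrow> 'k::zero_neq_one mpol" where
  "var i = Poly_Mapping.single (Poly_Mapping.single i 1) 1"

definition poly_ring :: "nat \<Rightarrow> 'k::field mpol ring" where
  "poly_ring n =
    \<lparr>carrier = {p. \<forall>m\<in>Poly_Mapping.keys p. Poly_Mapping.keys m \<subseteq> {1..n}},
     mult = (*), one = 1, zero = 0, add = (+)\<rparr>"

definition homog_poly :: "nat \<Rightarrow> nat \<Rightarrow> 'k::field mpol set" where
  "homog_poly n s = {p \<in> carrier (poly_ring n). \<forall>m\<in>Poly_Mapping.keys p. mon_deg m = s}"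

definition irrelevant_ideal :: "nat \<Rightarrow> 'k::field mpol set" where
  "irrelevant_ideal n = Idl\<^bsub>poly_ring n\<^esub> (var ` {1..n})"


section \<open>Hilbert series\<close>

text \<open>
  A graded module is given by a module \<open>M\<close> over \<open>poly_ring n\<close> and its family \<open>G\<close> of homogeneous
  components.  \<open>graded_piece M G s\<close> is \<open>G s\<close> as a vector space over \<open>k\<close>, which acts through the
  constant polynomials.
\<close>

definition graded_piece ::
    "('k::field mpol, 'm) module \<Rightarrow> (nat \<Rightarrow> 'm set) \<Rightarrow> nat \<Rightarrow> ('k, 'm) module" where
  "graded_piece M G s =
    \<lparr>carrier = G s, mult = mult M, one = one M, zero = zero M, add = add M,
     smult = (\<lambda>c x. const c \<odot>\<^bsub>M\<^esub> x)\<rparr>"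

definition hilbert_series :: "('k::field mpol, 'm) module \<Rightarrow> (nat \<Rightarrow> 'm set) \<Rightarrow> int fps" where
  "hilbert_series M G =
    Abs_fps (\<lambda>s. int (vectorspace.dim (class_ring :: 'k ring) (graded_piece M G s)))"


section \<open>Graded free modules and resolutions\<close>

text \<open>
  \<open>free_mod n as\<close> is the direct sum of the modules \<open>R(-a)\<close>, \<open>a\<close> running through the list \<open>as\<close>, i.e.
  the \<open>j\<close>-th basis vector is homogeneous of degree \<open>as ! j\<close>.  Only the grading depends on the
  entries of \<open>as\<close>.
\<close>

definition free_mod :: "nat \<Rightarrow> nat list \<Rightarrow> ('k::field mpol, 'k mpol vec) module" where
  "free_mod n as = module_vec TYPE('k mpol) (length as)
    \<lparr>carrier := {v \<in> carrier_vec (length as). \<forall>j<length as. v $ j \<in> carrier (poly_ring n)}\<rparr>"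

definition free_part :: "nat \<Rightarrow> nat list \<Rightarrow> nat \<Rightarrow> 'k::field mpol vec set" where
  "free_part n as s = {v \<in> carrier (free_mod n as).
     \<forall>j<length as. \<forall>m\<in>Poly_Mapping.keys (v $ j). mon_deg m + as ! j = s}"

text \<open>
  \<open>0 \<rightarrow> F\<^sub>L \<rightarrow> \<dots> \<rightarrow> F\<^sub>1 \<rightarrow> F\<^sub>0 \<rightarrow> M \<rightarrow> 0\<close> with \<open>F\<^sub>i = free_mod n (a i)\<close>, \<open>\<phi> i : F\<^sub>i\<^sub>+\<^sub>1 \<rightarrow> F\<^sub>i\<close> and the augmentation
  \<open>\<epsilon> : F\<^sub>0 \<rightarrow> M\<close>; the values of \<open>a\<close> beyond \<open>L\<close> and of \<open>\<phi>\<close> from \<open>L\<close> on play no role.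
\<close>

definition graded_free_resolution ::
    "nat \<Rightarrow> ('k::field mpol, 'm) module \<Rightarrow> (nat \<Rightarrow> 'm set) \<Rightarrow> nat \<Rightarrow> (nat \<Rightarrow> nat list) \<Rightarrow>
     (nat \<Rightarrow> 'k mpol vec \<Rightarrow> 'k mpol vec) \<Rightarrow> ('k mpol vec \<Rightarrow> 'm) \<Rightarrow> bool" where
  "graded_free_resolution n M G L a \<phi> \<epsilon> \<longleftrightarrow>
    (let F = (\<lambda>i. free_mod n (a i));
         B = (\<lambda>i. if i < L then \<phi> i ` carrier (F (Suc i)) else {\<zero>\<^bsub>F i\<^esub>})
     in \<epsilon> \<in> LinearCombinations.module_hom (poly_ring n) (F 0) M \<and>
        (\<forall>s. \<epsilon> ` free_part n (a 0) s \<subseteq> G s) \<and>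
        (\<forall>i<L. \<phi> i \<in> LinearCombinations.module_hom (poly_ring n) (F (Suc i)) (F i) \<and>
               (\<forall>s. \<phi> i ` free_part n (a (Suc i)) s \<subseteq> free_part n (a i) s)) \<and>
        \<epsilon> ` carrier (F 0) = carrier M \<and>
        a_kernel (F 0) M \<epsilon> = B 0 \<and>
        (\<forall>i<L. a_kernel (F (Suc i)) (F i) (\<phi> i) = B (Suc i)))"

text \<open>Minimality: the image of each \<open>F\<^sub>i\<^sub>+\<^sub>1 \<rightarrow> F\<^sub>i\<close> lies in \<open>(x\<^sub>1,\<dots>,x\<^sub>n) F\<^sub>i\<close>.\<close>

definition minimal_graded_free_resolution ::
    "nat \<Rightarrow> ('k::field mpol, 'm) module \<Rightarrow> (nat \<Rightarrow> 'm set) \<Rightarrow> nat \<Rightarrow> (nat \<Rightarrow> nat list) \<Rightarrow>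
     (nat \<Rightarrow> 'k mpol vec \<Rightarrow> 'k mpol vec) \<Rightarrow> ('k mpol vec \<Rightarrow> 'm) \<Rightarrow> bool" where
  "minimal_graded_free_resolution n M G L a \<phi> \<epsilon> \<longleftrightarrow>
    graded_free_resolution n M G L a \<phi> \<epsilon> \<and>
    (\<forall>i<L. \<forall>v\<in>carrier (free_mod n (a (Suc i))). \<forall>j<length (a i).
       \<phi> i v $ j \<in> irrelevant_ideal n)"


section \<open>Simplicial complexes and Stanley-Reisner rings\<close>

text \<open>Nonemptiness is only an extra condition for \<open>n = 0\<close>; it says that the empty set is a face.\<close>

definition simplicial_complex :: "nat \<Rightarrow> nat set set \<Rightarrow> bool" where
  "simplicial_complex n \<Delta> \<longleftrightarrow>
    \<Delta> \<noteq> {} \<and> (\<forall>F\<in>\<Delta>. F \<subseteq> {1..n}) \<and> (\<forall>F\<in>\<Delta>. \<forall>E. E \<subseteq> F \<longrightarrow> E \<in> \<Delta>) \<and> (\<forall>i\<in>{1..n}. {i} \<in> \<Delta>)"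

definition sc_dim :: "nat set set \<Rightarrow> int" where
  "sc_dim \<Delta> = Max ((\<lambda>F. int (card F) - 1) ` \<Delta>)"

definition sr_ideal :: "nat \<Rightarrow> nat set set \<Rightarrow> 'k::field mpol set" where
  "sr_ideal n \<Delta> = Idl\<^bsub>poly_ring n\<^esub> {(\<Prod>i\<in>F. var i) | F. F \<subseteq> {1..n} \<and> F \<notin> \<Delta>}"

definition sr_ring :: "nat \<Rightarrow> nat set set \<Rightarrow> 'k::field mpol set ring" where
  "sr_ring n \<Delta> = poly_ring n Quot sr_ideal n \<Delta>"

definition sr_module :: "nat \<Rightarrow> nat set set \<Rightarrow> ('k::field mpol, 'k mpol set) module" where
  "sr_module n \<Delta> =
    \<lparr>carrier = carrier (sr_ring n \<Delta>), mult = mult (sr_ring n \<Delta>), one = one (sr_ring n \<Delta>),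
     zero = zero (sr_ring n \<Delta>), add = add (sr_ring n \<Delta>),
     smult = (\<lambda>r X. (sr_ideal n \<Delta> +>\<^bsub>poly_ring n\<^esub> r) \<otimes>\<^bsub>sr_ring n \<Delta>\<^esub> X)\<rparr>"

definition sr_part :: "nat \<Rightarrow> nat set set \<Rightarrow> nat \<Rightarrow> 'k::field mpol set set" where
  "sr_part n \<Delta> s = (\<lambda>p. sr_ideal n \<Delta> +>\<^bsub>poly_ring n\<^esub> p) ` homog_poly n s"

text \<open>
  With \<open>dim \<Delta> = d - 1\<close>, the \<open>h\<close>-vector is the coefficient sequence of the numerator in
  \<open>H(z) = (h\<^sub>0 + h\<^sub>1 z + \<dots> + h\<^sub>d z\<^sup>d) / (1 - z)\<^sup>d\<close>, i.e. of \<open>H(z) (1 - z)\<^sup>d\<close>, extended by \<open>0\<close> beyond \<open>d\<close>.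
  The field enters through the Hilbert series and is passed as a type argument.
\<close>

definition h_vector :: "'k::field itself \<Rightarrow> nat \<Rightarrow> nat set set \<Rightarrow> nat \<Rightarrow> int" where
  "h_vector _ n \<Delta> j =
    (let d = nat (sc_dim \<Delta> + 1);
         H = hilbert_series (sr_module n \<Delta> :: ('k mpol, 'k mpol set) module) (sr_part n \<Delta>)
     in if j \<le> d then fps_nth (H * (1 - fps_X) ^ d) j else 0)"

text \<open>
  The resolution \<open>0 \<rightarrow> R(-c\<^sub>p)\<^bsup>\<beta>\<^sub>p\<^esup> \<rightarrow> \<dots> \<rightarrow> R(-c\<^sub>0)\<^bsup>\<beta>\<^sub>0\<^esup> \<rightarrow> R \<rightarrow> k[\<Delta>] \<rightarrow> 0\<close>: the module with index \<open>i\<close> here sits in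
  homological position \<open>i + 1\<close>, and position \<open>0\<close> is occupied by \<open>R = R(0)\<close>.
\<close>

definition has_pure_free_resolution ::
    "'k::field itself \<Rightarrow> nat \<Rightarrow> nat set set \<Rightarrow> nat \<Rightarrow> (nat \<Rightarrow> nat) \<Rightarrow> (nat \<Rightarrow> nat) \<Rightarrow> bool" where
  "has_pure_free_resolution _ n \<Delta> p c \<beta> \<longleftrightarrow>
    (\<forall>i\<le>p. 0 < \<beta> i) \<and> 0 < c 0 \<and> (\<forall>i<p. c i < c (Suc i)) \<and>
    (\<exists>\<phi> \<epsilon>. minimal_graded_free_resolution n
       (sr_module n \<Delta> :: ('k mpol, 'k mpol set) module) (sr_part n \<Delta>) (Suc p)
       (case_nat [0] (\<lambda>i. replicate (\<beta> i) (c i))) \<phi> \<epsilon>)"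

end

theory Submission
  imports Defs
begin

text \<open>
  Each strand of the resolution of a fixed degree is an exact sequence of finite-dimensional vector
  spaces, so the Hilbert series of \<open>k[\<Delta>]\<close> is the alternating sum of those of the free modules, which
  gives \<open>(1 - z)\<^sup>n H(z) = 1 + (\<Sum>i\<le>p. (-1)\<^bsup>i+1\<^esup> \<beta>\<^sub>i z\<^bsup>c i\<^esup>)\<close>.  On the other hand \<open>(1 - z)\<^sup>n H(z)\<close> is
  \<open>(1 - z)\<^bsup>n-d\<^esup>\<close> times the \<open>h\<close>-polynomial.  The degrees \<open>c i\<close> are distinct and positive, so comparing
  the coefficients of \<open>z\<^bsup>c i\<^esup>\<close> isolates \<open>\<beta>\<^sub>i\<close>.
\<close>

section \<open>Counting monomials by support\<close>

text \<open>The hypotheses speak of whole modules, whereas the dimension count takes place in one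
  degree at a time. Exactness descends to a degree by passing to homogeneous components of
  preimages. At the right end of the resolution, \<open>graded_free_resolution\<close> asserts only
  that \<epsilon> maps each degree into the corresponding component and that it is onto as a whole;
  that every component is attained is recovered from \<open>F\<^sub>0 = R\<close> having a single
  generator, in degree 0. Dimensions are found by exhibiting coordinates indexed by monomials, which
  turns every Hilbert series into a count that no longer involves the field. Sorting monomials by
  their support F yields the series \<open>z^|F| / (1 - z)^|F|\<close>. These identities are kept
  free of denominators by multiplying with powers of \<open>1 - z\<close>.\<close>

definition monomials :: "nat set set \<Rightarrow> nat \<Rightarrow> (nat \<Rightarrow>\<^sub>0 nat) set" where
  "monomials \<Delta> s = {m. Poly_Mapping.keys m \<in> \<Delta> \<and> mon_deg m = s}"

text \<open>The argument is an arbitrary set of supports, so that one notion covers three cases: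
  \<open>Pow {1..n}\<close> gives the Hilbert series of R, a complex \<Delta> that of k[\<Delta>],
  and \<open>{F}\<close> the contribution of a single support.\<close>

definition monomials_fps :: "nat set set \<Rightarrow> int fps" where
  "monomials_fps \<Delta> = Abs_fps (\<lambda>s. int (card (monomials \<Delta> s)))"

text \<open>Exponents are natural numbers, so nothing cancels; for general coefficients only an
  inclusion would hold.\<close>

lemma keys_add_nat:
  "Poly_Mapping.keys (a + b :: nat \<Rightarrow>\<^sub>0 nat) = Poly_Mapping.keys a \<union> Poly_Mapping.keys b"
  by (auto simp: in_keys_iff lookup_add)

lemma mon_deg_superset:
  assumes "finite A" "Poly_Mapping.keys m \<subseteq> A"
  shows "mon_deg m = (\<Sum>i\<in>A. Poly_Mapping.lookup m i)"
  unfolding mon_deg_def using assms by (intro sum.mono_neutral_left) (auto simp: in_keys_iff)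

lemma mon_deg_add: "mon_deg (a + b) = mon_deg a + mon_deg b"
proof -
  let ?A = "Poly_Mapping.keys a \<union> Poly_Mapping.keys b"
  have "mon_deg (a + b) = (\<Sum>i\<in>?A. Poly_Mapping.lookup (a + b) i)"
    by (rule mon_deg_superset) (auto simp: keys_add_nat)
  also have "\<dots> = mon_deg a + mon_deg b"
    by (simp add: lookup_add sum.distrib mon_deg_superset[of ?A])
  finally show ?thesis .
qed

lemma mon_deg_single [simp]: "mon_deg (Poly_Mapping.single i k) = k"
  by (cases "k = 0") (auto simp: mon_deg_def)

lemma mon_deg_0 [simp]: "mon_deg 0 = 0"
  by (simp add: mon_deg_def)

lemma mon_deg_eq_0_iff [simp]: "mon_deg m = 0 \<longleftrightarrow> m = 0"
  by (auto simp: mon_deg_def in_keys_iff intro!: poly_mapping_eqI)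

text \<open>Dividing by \<open>x\<^sub>i\<close> leaves the variable present if its exponent was at
  least 2 and removes it if the exponent was 1, hence the two possible supports on the left. This is
  the recursion behind all counts below.\<close>

lemma monomials_insert_Suc:
  assumes "i \<notin> F"
  shows "bij_betw (\<lambda>m. m + Poly_Mapping.single i 1) (monomials {insert i F, F} s)
           (monomials {insert i F} (Suc s))"
proof (rule bij_betwI[where g = "\<lambda>m. m - Poly_Mapping.single i 1"])
  show "(\<lambda>m. m + Poly_Mapping.single i 1) \<in> monomials {insert i F, F} s \<rightarrow> monomials {insert i F} (Suc s)"
  proof
    fix m assume "m \<in> monomials {insert i F, F} s"
    then have "insert i (Poly_Mapping.keys m) = insert i F" "mon_deg m = s"
      unfolding monomials_def by auto
    then show "m + Poly_Mapping.single i 1 \<in> monomials {insert i F} (Suc s)"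
      by (simp add: monomials_def keys_add_nat mon_deg_add)
  qed
  show "(\<lambda>m. m - Poly_Mapping.single i 1) \<in> monomials {insert i F} (Suc s) \<rightarrow> monomials {insert i F, F} s"
  proof
    fix m assume m: "m \<in> monomials {insert i F} (Suc s)"
    let ?m = "m - Poly_Mapping.single i 1"
    \<comment> \<open>Subtraction of exponents is truncated; adding the variable back undoes it
      because its exponent is positive.\<close>
    have "Poly_Mapping.lookup m i > 0"
      using m by (auto simp: monomials_def in_keys_iff)
    then have eq: "?m + Poly_Mapping.single i 1 = m"
      by (intro poly_mapping_eqI) (auto simp: lookup_add lookup_minus lookup_single when_def)
    have "mon_deg ?m + 1 = Suc s"
      using m eq mon_deg_add[of ?m "Poly_Mapping.single i 1"] by (simp add: monomials_def)
    moreover have "insert i (Poly_Mapping.keys ?m) = insert i F"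
      using m eq keys_add_nat[of ?m "Poly_Mapping.single i 1"] by (simp add: monomials_def)
    then have "Poly_Mapping.keys ?m \<in> {insert i F, F}"
      using assms by (cases "i \<in> Poly_Mapping.keys ?m") auto
    ultimately show "?m \<in> monomials {insert i F, F} s"
      by (simp add: monomials_def)
  qed
  show "m - Poly_Mapping.single i 1 + Poly_Mapping.single i 1 = m"
    if "m \<in> monomials {insert i F} (Suc s)" for m
  proof -
    have "Poly_Mapping.lookup m i > 0"
      using that by (auto simp: monomials_def in_keys_iff)
    then show ?thesis
      by (intro poly_mapping_eqI) (auto simp: lookup_add lookup_minus lookup_single when_def)
  qed
qed simp

lemma monomials_insert_0: "monomials {insert i F} 0 = {}"
  by (auto simp: monomials_def)

lemma monomials_empty: "monomials {{}} s = (if s = 0 then {0} else {})"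
  by (auto simp: monomials_def)

lemma monomials_Un: "monomials (A \<union> B) s = monomials A s \<union> monomials B s"
  by (auto simp: monomials_def)

lemma monomials_UN: "monomials \<Delta> s = (\<Union>F\<in>\<Delta>. monomials {F} s)"
  by (auto simp: monomials_def)

text \<open>Division by \<open>x\<^sub>i\<close> lowers the degree but may keep the support, which
  is why an induction on \<open>s\<close> sits inside the one on F.\<close>

lemma finite_monomials_single:
  assumes "finite F"
  shows "finite (monomials {F} s)"
  using assms
proof (induction F arbitrary: s rule: finite_induct)
  case empty
  show ?case by (simp add: monomials_empty)
next
  case (insert i F)
  show ?case
  proof (induction s)
    case 0
    show ?case by (simp add: monomials_insert_0)
  next
    case (Suc s)
    have "finite (monomials {insert i F, F} s)"
      using Suc insert.IH[of s] monomials_Un[of "{insert i F}" "{F}" s] by (simp add: insert_commute)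
    then show ?case
      using bij_betw_finite[OF monomials_insert_Suc[OF insert.hyps(2), of s]] by simp
  qed
qed

lemma finite_monomials:
  assumes "finite \<Delta>" "\<And>F. F \<in> \<Delta> \<Longrightarrow> finite F"
  shows "finite (monomials \<Delta> s)"
  by (subst monomials_UN) (use assms finite_monomials_single in blast)

lemma monomials_fps_sum:
  assumes "finite \<Delta>" "\<And>F. F \<in> \<Delta> \<Longrightarrow> finite F"
  shows "monomials_fps \<Delta> = (\<Sum>F\<in>\<Delta>. monomials_fps {F})"
proof (rule fps_ext)
  fix s
  have "card (monomials \<Delta> s) = (\<Sum>F\<in>\<Delta>. card (monomials {F} s))"
    by (subst monomials_UN, subst card_UN_disjoint)
      (use assms finite_monomials_single in \<open>auto simp: monomials_def\<close>)
  then show "fps_nth (monomials_fps \<Delta>) s = fps_nth (\<Sum>F\<in>\<Delta>. monomials_fps {F}) s"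
    by (simp add: monomials_fps_def fps_sum_nth)
qed

lemma monomials_fps_empty: "monomials_fps {{}} = 1"
  by (rule fps_ext) (simp add: monomials_fps_def monomials_empty)

text \<open>Write P(F) for the series of support F. The bijection above says
  \<open>P(insert i F) = z (P(insert i F) + P(F))\<close>, there being no monomial of degree 0 whose
  support contains i.\<close>

lemma monomials_fps_insert:
  assumes "finite F" "i \<notin> F"
  shows "(1 - fps_X) * monomials_fps {insert i F} = fps_X * monomials_fps {F}"
proof (rule fps_ext)
  fix s
  show "fps_nth ((1 - fps_X) * monomials_fps {insert i F}) s = fps_nth (fps_X * monomials_fps {F}) s"
  proof (cases s)
    case 0
    then show ?thesis by (simp add: monomials_fps_def monomials_insert_0)
  next
    case (Suc t)
    have "card (monomials {insert i F} (Suc t)) = card (monomials {insert i F, F} t)"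
      using bij_betw_same_card[OF monomials_insert_Suc[OF assms(2), of t]] by simp
    also have "monomials {insert i F, F} t = monomials {insert i F} t \<union> monomials {F} t"
      by (auto simp: monomials_def)
    also have "card \<dots> = card (monomials {insert i F} t) + card (monomials {F} t)"
      by (rule card_Un_disjoint) (use assms finite_monomials_single in \<open>auto simp: monomials_def\<close>)
    finally show ?thesis
      using Suc by (simp add: monomials_fps_def algebra_simps)
  qed
qed

text \<open>Every variable of F has a positive exponent and so contributes a factor
  \<open>z / (1 - z)\<close>.\<close>

lemma monomials_fps_single:
  assumes "finite F"
  shows "(1 - fps_X) ^ card F * monomials_fps {F} = fps_X ^ card F"
  using assms
proof (induction F rule: finite_induct)
  case empty
  then show ?case by (simp add: monomials_fps_empty)
next
  case (insert i F)
  have "(1 - fps_X) ^ card (insert i F) * monomials_fps {insert i F} =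
      (1 - fps_X) ^ card F * ((1 - fps_X) * monomials_fps {insert i F})"
    using insert.hyps by (simp add: mult_ac)
  also have "\<dots> = fps_X * ((1 - fps_X) ^ card F * monomials_fps {F})"
    using insert.hyps by (simp add: monomials_fps_insert mult_ac)
  also have "\<dots> = fps_X ^ card (insert i F)"
    using insert by simp
  finally show ?case .
qed

text \<open>This is the Hilbert series of a polynomial ring in the variables of F. Supports inside
  \<open>insert i F\<close> are paired as G and \<open>insert i G\<close>; after multiplication by
  \<open>1 - z\<close> a pair contributes \<open>(1 - z) P(G) + z P(G) = P(G)\<close>.\<close>

lemma monomials_fps_Pow:
  assumes "finite F"
  shows "(1 - fps_X) ^ card F * monomials_fps (Pow F) = 1"
  using assms
proof (induction F rule: finite_induct)
  case empty
  then show ?case by (simp add: monomials_fps_empty)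
next
  case (insert i F)
  have fin: "finite G" if "G \<subseteq> F" for G
    using that insert.hyps finite_subset by blast
  have inj: "inj_on (insert i) (Pow F)"
    using insert.hyps by (auto simp: inj_on_def)
  have "monomials_fps (Pow (insert i F)) = (\<Sum>G\<in>Pow (insert i F). monomials_fps {G})"
    by (rule monomials_fps_sum) (use insert.hyps finite_subset in auto)
  also have "\<dots> = (\<Sum>G\<in>Pow F. monomials_fps {G}) + (\<Sum>G\<in>insert i ` Pow F. monomials_fps {G})"
    by (subst Pow_insert, subst sum.union_disjoint) (use insert.hyps in auto)
  also have "\<dots> = (\<Sum>G\<in>Pow F. monomials_fps {G} + monomials_fps {insert i G})"
    by (simp add: sum.reindex[OF inj] sum.distrib)
  finally have "(1 - fps_X) * monomials_fps (Pow (insert i F)) =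
      (\<Sum>G\<in>Pow F. (1 - fps_X) * monomials_fps {G} + (1 - fps_X) * monomials_fps {insert i G})"
    by (simp add: sum_distrib_left distrib_left)
  also have "\<dots> = (\<Sum>G\<in>Pow F. monomials_fps {G})"
  proof (rule sum.cong)
    fix G assume "G \<in> Pow F"
    then have "finite G" "i \<notin> G" using insert.hyps fin by auto
    then show "(1 - fps_X) * monomials_fps {G} + (1 - fps_X) * monomials_fps {insert i G} = monomials_fps {G}"
      by (simp add: monomials_fps_insert) (simp add: algebra_simps)
  qed simp
  also have "\<dots> = monomials_fps (Pow F)"
    by (rule monomials_fps_sum[symmetric]) (use insert.hyps fin in auto)
  finally have "(1 - fps_X) ^ card (insert i F) * monomials_fps (Pow (insert i F)) =
      (1 - fps_X) ^ card F * monomials_fps (Pow F)"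
    using insert.hyps by (simp add: mult_ac)
  then show ?case
    using insert.IH by simp
qed

section \<open>Powers of \<open>1 - z\<close> and the degree of the h-polynomial\<close>

lemma fps_nth_one_minus_X_power:
  "fps_nth ((1 - fps_X :: int fps) ^ m) l = (-1) ^ l * int (m choose l)"
proof (induction m arbitrary: l)
  case 0
  show ?case by (cases l) auto
next
  case (Suc m)
  have "fps_nth ((1 - fps_X :: int fps) ^ Suc m) l =
      fps_nth ((1 - fps_X) ^ m) l - (if l = 0 then 0 else fps_nth ((1 - fps_X) ^ m) (l - 1))"
    by (simp add: left_diff_distrib)
  then show ?case
    by (cases l) (simp_all add: Suc algebra_simps)
qed

text \<open>A face F contributes the polynomial \<open>z^|F| (1 - z)^(d - |F|)\<close>, of degree d.
  The bound on the cardinalities keeps the second exponent from being a truncated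
  difference.\<close>

lemma monomials_fps_mult_power_nth:
  assumes fin: "finite \<Delta>" and F: "\<And>F. F \<in> \<Delta> \<Longrightarrow> finite F \<and> card F \<le> d" and "d < j"
  shows "fps_nth (monomials_fps \<Delta> * (1 - fps_X) ^ d) j = 0"
proof -
  have "monomials_fps \<Delta> * (1 - fps_X) ^ d = (\<Sum>F\<in>\<Delta>. monomials_fps {F} * (1 - fps_X) ^ d)"
    using monomials_fps_sum[OF fin] F by (simp add: sum_distrib_right)
  also have "\<dots> = (\<Sum>F\<in>\<Delta>. fps_X ^ card F * (1 - fps_X) ^ (d - card F))"
  proof (rule sum.cong)
    fix G assume "G \<in> \<Delta>"
    then have "(1 - fps_X :: int fps) ^ d = (1 - fps_X) ^ card G * (1 - fps_X) ^ (d - card G)"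
      and "finite G"
      using F by (simp_all flip: power_add)
    then show "monomials_fps {G} * (1 - fps_X) ^ d = fps_X ^ card G * (1 - fps_X) ^ (d - card G)"
      using monomials_fps_single[of G] by (simp add: mult_ac flip: mult.assoc)
  qed simp
  also have "fps_nth \<dots> j = (\<Sum>F\<in>\<Delta>. 0)"
    unfolding fps_sum_nth
  proof (rule sum.cong)
    fix G assume "G \<in> \<Delta>"
    then have "card G \<le> d" using F by blast
    then show "fps_nth (fps_X ^ card G * (1 - fps_X) ^ (d - card G) :: int fps) j = 0"
      using \<open>d < j\<close> by (simp add: fps_X_power_mult_nth fps_nth_one_minus_X_power binomial_eq_0)
  qed simp
  finally show ?thesis by simp
qed

section \<open>Coordinates on graded pieces\<close>

lemma carrier_poly_ring:
  "p \<in> carrier (poly_ring n) \<longleftrightarrow> (\<forall>m\<in>Poly_Mapping.keys p. Poly_Mapping.keys m \<subseteq> {1..n})"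
  by (simp add: poly_ring_def)

lemma poly_ring_simps [simp]:
  "p \<otimes>\<^bsub>poly_ring n\<^esub> q = p * q" "p \<oplus>\<^bsub>poly_ring n\<^esub> q = p + q"
  "\<one>\<^bsub>poly_ring n\<^esub> = 1" "\<zero>\<^bsub>poly_ring n\<^esub> = 0"
  by (simp_all add: poly_ring_def)

lemma poly_ring_closed [simp]:
  fixes p q :: "'k::field mpol"
  shows "0 \<in> carrier (poly_ring n)" "1 \<in> carrier (poly_ring n)"
    "p \<in> carrier (poly_ring n) \<Longrightarrow> q \<in> carrier (poly_ring n) \<Longrightarrow> p + q \<in> carrier (poly_ring n)"
    "p \<in> carrier (poly_ring n) \<Longrightarrow> q \<in> carrier (poly_ring n) \<Longrightarrow> p * q \<in> carrier (poly_ring n)"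
    "p \<in> carrier (poly_ring n) \<Longrightarrow> - p \<in> carrier (poly_ring n)"
proof -
  show "0 \<in> carrier (poly_ring n)" "1 \<in> carrier (poly_ring n)"
    by (auto simp: carrier_poly_ring)
  show "p + q \<in> carrier (poly_ring n)" if "p \<in> carrier (poly_ring n)" "q \<in> carrier (poly_ring n)"
    using that keys_add[of p q] by (auto simp: carrier_poly_ring)
  show "p * q \<in> carrier (poly_ring n)" if "p \<in> carrier (poly_ring n)" "q \<in> carrier (poly_ring n)"
  proof -
    have "\<exists>a b. m = a + b \<and> a \<in> Poly_Mapping.keys p \<and> b \<in> Poly_Mapping.keys q"
      if "m \<in> Poly_Mapping.keys (p * q)" for m
      using that keys_mult[of p q] by blast
    then show ?thesis
      using that by (fastforce simp: carrier_poly_ring keys_add_nat)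
  qed
  show "- p \<in> carrier (poly_ring n)" if "p \<in> carrier (poly_ring n)"
    using that by (auto simp: carrier_poly_ring in_keys_iff)
qed

lemma const_closed [simp]: "const c \<in> carrier (poly_ring n)"
  by (auto simp: carrier_poly_ring const_def split: if_splits)

lemma const_simps:
  fixes a b :: "'k::field"
  shows "const (a + b) = const a + const b" "const (a * b) = const a * const b"
    "const (1 :: 'k) = 1" "const (0 :: 'k) = 0"
  by (simp_all add: const_def single_add mult_single single_one)

lemma lookup_const_mult [simp]:
  fixes c :: "'k::field"
  shows "Poly_Mapping.lookup (const c * p) m = c * Poly_Mapping.lookup p m"
  by (simp add: const_def map.rep_eq when_def flip: mult_map_scale_conv_mult)

lemma cring_poly_ring: "cring (poly_ring n :: 'k::field mpol ring)"
proof (intro cringI abelian_groupI comm_monoidI)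
  show "\<exists>q\<in>carrier (poly_ring n). q \<oplus>\<^bsub>poly_ring n\<^esub> p = \<zero>\<^bsub>poly_ring n\<^esub>"
    if "p \<in> carrier (poly_ring n)" for p :: "'k mpol"
    using that by (intro bexI[of _ "- p"]) simp_all
qed (simp_all add: algebra_simps)

lemma ex_poly_mapping:
  assumes "finite A"
  shows "\<exists>p. \<forall>m. Poly_Mapping.lookup p m = (if m \<in> A then g m else 0)"
proof -
  have "finite {m. (if m \<in> A then g m else 0) \<noteq> 0}"
    by (rule finite_subset[OF _ assms]) auto
  then show ?thesis
    by (intro exI[of _ "Abs_poly_mapping (\<lambda>m. if m \<in> A then g m else 0)"]) simp
qed

lemma vectorspace_graded_piece:
  fixes M :: "('k::field mpol, 'm) module"
  assumes "module (poly_ring n) M"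
    and sub: "G s \<subseteq> carrier M" "\<zero>\<^bsub>M\<^esub> \<in> G s"
    and add: "\<And>x y. x \<in> G s \<Longrightarrow> y \<in> G s \<Longrightarrow> x \<oplus>\<^bsub>M\<^esub> y \<in> G s"
    and smult: "\<And>c x. x \<in> G s \<Longrightarrow> const c \<odot>\<^bsub>M\<^esub> x \<in> G s"
  shows "vectorspace class_ring (graded_piece M G s)"
proof -
  interpret M: module "poly_ring n" M by fact
  \<comment> \<open>All of M is first regarded as a vector space over k. Then \<open>G s\<close> is
    a subspace, and its additive inverses, absent from the assumptions, come from the general
    theory.\<close>
  let ?N = "graded_piece M (\<lambda>_. carrier M) s"
  have "abelian_group ?N"
    by (rule abelian_groupI)
      (auto simp: graded_piece_def M.a_ac intro: M.l_neg exI[of _ "\<ominus>\<^bsub>M\<^esub> _"] bexI[of _ "\<ominus>\<^bsub>M\<^esub> _"])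
  moreover have "const (a + b) \<odot>\<^bsub>M\<^esub> x = const a \<odot>\<^bsub>M\<^esub> x \<oplus>\<^bsub>M\<^esub> const b \<odot>\<^bsub>M\<^esub> x"
    "const (a * b) \<odot>\<^bsub>M\<^esub> x = const a \<odot>\<^bsub>M\<^esub> (const b \<odot>\<^bsub>M\<^esub> x)" "const 1 \<odot>\<^bsub>M\<^esub> x = x"
    if "x \<in> carrier M" for a b :: 'k and x
    using M.smult_l_distr[of "const a" "const b" x] M.smult_assoc1[of "const a" "const b" x]
      M.smult_one[of x] that
    by (simp_all add: const_simps)
  ultimately have "module class_ring ?N"
    by (intro moduleI class_cring.cring_axioms)
      (auto simp: graded_piece_def intro: M.smult_r_distr)
  then interpret N: module class_ring ?N .
  have "submodule class_ring (G s) ?N"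
    using sub add smult by (intro submodule.intro N.module_axioms) (auto simp: graded_piece_def)
  then have "module class_ring (?N\<lparr>carrier := G s\<rparr>)"
    by (rule N.submodule_is_module)
  moreover have "?N\<lparr>carrier := G s\<rparr> = graded_piece M G s"
    by (simp add: graded_piece_def)
  ultimately show ?thesis
    by (simp add: vectorspace_def class_field)
qed

text \<open>No basis is named and no linear combination is formed: the inverse of the coordinate map
  is a linear bijection from \<open>k^|B|\<close>, whose dimension is known.\<close>

lemma dim_by_coordinates:
  fixes V :: "('k::field, 'v) module" and coord :: "'v \<Rightarrow> 'b \<Rightarrow> 'k"
  assumes V: "vectorspace class_ring V" and "finite B"
    and add: "\<And>x y b. x \<in> carrier V \<Longrightarrow> y \<in> carrier V \<Longrightarrow> b \<in> B \<Longrightarrow>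
      coord (x \<oplus>\<^bsub>V\<^esub> y) b = coord x b + coord y b"
    and smult: "\<And>c x b. x \<in> carrier V \<Longrightarrow> b \<in> B \<Longrightarrow> coord (c \<odot>\<^bsub>V\<^esub> x) b = c * coord x b"
    and inj: "\<And>x y. x \<in> carrier V \<Longrightarrow> y \<in> carrier V \<Longrightarrow> (\<And>b. b \<in> B \<Longrightarrow> coord x b = coord y b) \<Longrightarrow> x = y"
    and surj: "\<And>f. \<exists>x\<in>carrier V. \<forall>b\<in>B. coord x b = f b"
  shows "vectorspace.fin_dim class_ring V" "vectorspace.dim class_ring V = card B"
proof -
  interpret V: vectorspace class_ring V by fact
  interpret W: vec_space "TYPE('k)" "card B" .
  obtain e where e: "bij_betw e {..<card B} B"
    using ex_bij_betw_nat_finite[OF \<open>finite B\<close>] by (auto simp: atLeast0LessThan)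
  have "\<exists>x\<in>carrier V. \<forall>i<card B. coord x (e i) = w $ i" for w
  proof -
    obtain x where x: "x \<in> carrier V" "\<forall>b\<in>B. coord x b = w $ (inv_into {..<card B} e b)"
      using surj[of "\<lambda>b. w $ (inv_into {..<card B} e b)"] by auto
    then show ?thesis
      using bij_betw_inv_into_left[OF e] bij_betwE[OF e] by (intro bexI[of _ x]) auto
  qed
  \<comment> \<open>T is chosen pointwise from surjectivity of the coordinates. Its linearity comes
    afterwards, because an element is determined by its coordinates.\<close>
  then obtain T where T: "T w \<in> carrier V" "\<And>i. i < card B \<Longrightarrow> coord (T w) (e i) = w $ i" for w
    by metis
  have eqI: "x = y" if "x \<in> carrier V" "y \<in> carrier V" "\<And>i. i < card B \<Longrightarrow> coord x (e i) = coord y (e i)" for x y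
    using that e by (intro inj) (auto simp: bij_betw_def dest!: equalityD2[THEN subsetD])
  have eB: "e i \<in> B" if "i < card B" for i
    using that e by (auto simp: bij_betw_def)
  have "T \<in> LinearCombinations.module_hom class_ring W.V V"
    unfolding module_hom_def
    by (auto simp: T V.smult_closed eB add smult module_vec_simps class_ring_simps intro!: eqI)
  then interpret T: linear_map class_ring W.V V T
    by (intro linear_map.intro mod_hom.intro mod_hom_axioms.intro) unfold_locales
  have "inj_on T (carrier W.V)"
  proof (rule inj_onI)
    fix v w assume "v \<in> carrier W.V" "w \<in> carrier W.V" "T v = T w"
    then show "v = w"
      using T(2)[of _ v] T(2)[of _ w] by (intro eq_vecI) (auto simp: module_vec_simps)
  qed
  moreover have "T ` carrier W.V = carrier V"
  proof (intro equalityI subsetI)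
    fix x assume x: "x \<in> carrier V"
    then have "x = T (vec (card B) (\<lambda>i. coord x (e i)))"
      by (intro eqI) (auto simp: T)
    then show "x \<in> T ` carrier W.V"
      by (auto simp: module_vec_simps)
  qed (auto simp: T)
  ultimately show "V.fin_dim" "V.dim = card B"
    using T.dim_eq[OF W.fin_dim] T.surj_fin_dim[OF W.fin_dim] W.dim_is_n
    by (simp_all add: module_vec_simps)
qed

section \<open>Graded free modules\<close>

lemma free_mod_simps [simp]:
  "carrier (free_mod n as :: ('k::field mpol, 'k mpol vec) module) =
    {v \<in> carrier_vec (length as). \<forall>j<length as. v $ j \<in> carrier (poly_ring n)}"
  "v \<oplus>\<^bsub>(free_mod n as :: ('k::field mpol, 'k mpol vec) module)\<^esub> w = v + w"
  "\<zero>\<^bsub>(free_mod n as :: ('k::field mpol, 'k mpol vec) module)\<^esub> = 0\<^sub>v (length as)"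
  "r \<odot>\<^bsub>(free_mod n as :: ('k::field mpol, 'k mpol vec) module)\<^esub> v = r \<cdot>\<^sub>v v"
  by (auto simp: free_mod_def module_vec_def)

lemma free_part_iff:
  "v \<in> free_part n as s \<longleftrightarrow> v \<in> carrier (free_mod n as) \<and>
     (\<forall>j<length as. \<forall>m. Poly_Mapping.lookup (v $ j) m \<noteq> 0 \<longrightarrow> mon_deg m + as ! j = s)"
  by (auto simp: free_part_def in_keys_iff)

lemma module_free_mod: "module (poly_ring n) (free_mod n as :: ('k::field mpol, 'k mpol vec) module)"
proof (rule moduleI)
  show "cring (poly_ring n :: 'k mpol ring)"
    by (rule cring_poly_ring)
  show "abelian_group (free_mod n as :: ('k mpol, 'k mpol vec) module)"
  proof (rule abelian_groupI)
    show "\<exists>w\<in>carrier (free_mod n as). w \<oplus>\<^bsub>free_mod n as\<^esub> v = \<zero>\<^bsub>free_mod n as\<^esub>"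
      if "v \<in> carrier (free_mod n as)" for v :: "'k mpol vec"
      using that by (intro bexI[of _ "- v"]) auto
  qed auto
qed (auto simp: smult_add_distrib_vec add_smult_distrib_vec smult_smult_assoc)

lemma free_part_subset: "free_part n as s \<subseteq> carrier (free_mod n as)"
  by (auto simp: free_part_iff)

lemma free_part_dim: "v \<in> free_part n as s \<Longrightarrow> dim_vec v = length as"
  by (simp add: free_part_iff)

lemma free_part_degree:
  "v \<in> free_part n as s \<Longrightarrow> j < length as \<Longrightarrow> Poly_Mapping.lookup (v $ j) m \<noteq> 0 \<Longrightarrow>
    mon_deg m + as ! j = s"
  by (simp add: free_part_iff)

lemma free_part_add:
  fixes x y :: "'k::field mpol vec"
  assumes "x \<in> free_part n as s" "y \<in> free_part n as s"
  shows "x + y \<in> free_part n as s"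
  unfolding free_part_iff
proof (intro conjI allI impI)
  show "x + y \<in> carrier (free_mod n as)"
    using assms[THEN subsetD[OF free_part_subset]] by auto
  fix j m assume j: "j < length as" and "Poly_Mapping.lookup ((x + y) $ j) m \<noteq> 0"
  then have "Poly_Mapping.lookup (x $ j) m \<noteq> 0 \<or> Poly_Mapping.lookup (y $ j) m \<noteq> 0"
    using assms by (auto simp: lookup_add free_part_dim)
  then show "mon_deg m + as ! j = s"
    using assms j free_part_degree by blast
qed

lemma vectorspace_free_part:
  "vectorspace class_ring (graded_piece (free_mod n as :: ('k::field mpol, 'k mpol vec) module) (free_part n as) s)"
proof (rule vectorspace_graded_piece[OF module_free_mod free_part_subset])
  show "const c \<odot>\<^bsub>free_mod n as\<^esub> x \<in> free_part n as s" if "x \<in> free_part n as s" for c and x :: "'k mpol vec"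
    unfolding free_part_iff
  proof (intro conjI allI impI)
    show "const c \<odot>\<^bsub>free_mod n as\<^esub> x \<in> carrier (free_mod n as)"
      using subsetD[OF free_part_subset that] by auto
    fix j m assume "j < length as" "Poly_Mapping.lookup ((const c \<odot>\<^bsub>free_mod n as\<^esub> x) $ j) m \<noteq> 0"
    then show "mon_deg m + as ! j = s"
      using that by (intro free_part_degree[OF that]) (auto simp: free_part_dim)
  qed
qed (simp_all add: free_part_add, simp add: free_part_iff)

lemma dim_free_part:
  fixes n as s
  defines "V \<equiv> graded_piece (free_mod n as :: ('k::field mpol, 'k mpol vec) module) (free_part n as) s"
  shows "vectorspace.fin_dim class_ring V"
    and "vectorspace.dim class_ring V =
      (\<Sum>j<length as. if as ! j \<le> s then card (monomials (Pow {1..n}) (s - as ! j)) else 0)"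
proof -
  \<comment> \<open>The index \<open>(j, m)\<close> stands for the basis element \<open>x^m\<close>
    times the j-th generator. The case distinction matters: for a generator of degree above
    \<open>s\<close> the truncated difference would be 0 and would wrongly admit the monomial
    1.\<close>
  define A where "A = (\<lambda>j. if as ! j \<le> s then monomials (Pow {1..n}) (s - as ! j) else {})"
  define B where "B = Sigma {..<length as} A"
  define coord :: "'k mpol vec \<Rightarrow> nat \<times> (nat \<Rightarrow>\<^sub>0 nat) \<Rightarrow> 'k"
    where "coord = (\<lambda>v b. Poly_Mapping.lookup (v $ fst b) (snd b))"
  have carrV: "carrier V = free_part n as s"
    by (simp add: V_def graded_piece_def)
  have finA: "finite (A j)" for j
    unfolding A_def
    using finite_monomials[of "Pow {1..n}" "s - as ! j"] finite_subset[of _ "{1..n}"] by auto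
  have A: "m \<in> A j" if "v \<in> free_part n as s" "j < length as" "Poly_Mapping.lookup (v $ j) m \<noteq> 0"
    for v :: "'k mpol vec" and j m
  proof -
    have "mon_deg m + as ! j = s" "Poly_Mapping.keys m \<subseteq> {1..n}"
      using that by (auto simp: free_part_iff carrier_poly_ring in_keys_iff)
    then show ?thesis
      by (auto simp: monomials_def A_def)
  qed
  have V: "vectorspace class_ring V"
    unfolding V_def by (rule vectorspace_free_part)
  have "finite B"
    unfolding B_def using finA by (intro finite_SigmaI) auto
  have add: "coord (x \<oplus>\<^bsub>V\<^esub> y) b = coord x b + coord y b"
    if "x \<in> carrier V" "y \<in> carrier V" "b \<in> B" for x y b
    using that by (auto simp: coord_def B_def V_def graded_piece_def lookup_add dest: free_part_dim)
  have smult: "coord (c \<odot>\<^bsub>V\<^esub> x) b = c * coord x b" if "x \<in> carrier V" "b \<in> B" for c x b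
    using that by (auto simp: coord_def B_def V_def graded_piece_def dest: free_part_dim)
  have inj: "x = y" if xy: "x \<in> carrier V" "y \<in> carrier V" and eq: "\<And>b. b \<in> B \<Longrightarrow> coord x b = coord y b" for x y
  proof (rule eq_vecI)
    show "dim_vec x = dim_vec y"
      using xy by (simp add: carrV free_part_dim)
    fix j assume "j < dim_vec y"
    then have j: "j < length as"
      using xy by (simp add: carrV free_part_dim)
    show "x $ j = y $ j"
    proof (rule poly_mapping_eqI)
      fix m
      show "Poly_Mapping.lookup (x $ j) m = Poly_Mapping.lookup (y $ j) m"
      proof (cases "m \<in> A j")
        case True
        then show ?thesis
          using eq[of "(j, m)"] j by (simp add: B_def coord_def)
      next
        case False
        then show ?thesis
          using A[of x j m] A[of y j m] xy j unfolding carrV by metis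
      qed
    qed
  qed
  have surj: "\<exists>x\<in>carrier V. \<forall>b\<in>B. coord x b = f b" for f
  proof -
    have "\<forall>j. \<exists>p. \<forall>m. Poly_Mapping.lookup p m = (if m \<in> A j then f (j, m) else 0)"
      using ex_poly_mapping[OF finA] by (intro allI)
    then obtain p where p: "Poly_Mapping.lookup (p j) m = (if m \<in> A j then f (j, m) else 0)" for j m
      by metis
    have p_nz: "Poly_Mapping.keys m \<subseteq> {1..n} \<and> mon_deg m + as ! j = s"
      if "Poly_Mapping.lookup (p j) m \<noteq> 0" for j m
      using that by (simp add: p A_def monomials_def split: if_splits)
    then have "p j \<in> carrier (poly_ring n)" for j
      by (simp add: carrier_poly_ring in_keys_iff)
    then have "vec (length as) p \<in> carrier V"
      using p_nz by (simp add: carrV free_part_iff)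
    then show ?thesis
      by (intro bexI[of _ "vec (length as) p"]) (auto simp: p coord_def B_def)
  qed
  have card_B: "card B = (\<Sum>j<length as. if as ! j \<le> s then card (monomials (Pow {1..n}) (s - as ! j)) else 0)"
    unfolding B_def using finA by (subst card_SigmaI) (auto intro!: sum.cong simp: A_def)
  note dim = dim_by_coordinates[OF V \<open>finite B\<close> add smult inj surj]
  show "vectorspace.fin_dim class_ring V"
    by (rule dim(1))
  show "vectorspace.dim class_ring V =
      (\<Sum>j<length as. if as ! j \<le> s then card (monomials (Pow {1..n}) (s - as ! j)) else 0)"
    unfolding card_B[symmetric] by (rule dim(2))
qed

lemma hilbert_series_free_mod:
  "hilbert_series (free_mod n as :: ('k::field mpol, 'k mpol vec) module) (free_part n as) =
    (\<Sum>j<length as. fps_X ^ (as ! j)) * monomials_fps (Pow {1..n})"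
  by (rule fps_ext)
    (auto simp: hilbert_series_def dim_free_part sum_distrib_right fps_sum_nth fps_X_power_mult_nth
      monomials_fps_def intro!: sum.cong)

text \<open>Selecting by a predicate on total degrees serves two purposes: \<open>t = s\<close> cuts
  out a homogeneous component, \<open>t < N\<close> a partial sum of components for induction on
  N.\<close>

definition truncate_free :: "nat list \<Rightarrow> (nat \<Rightarrow> bool) \<Rightarrow> 'k::field mpol vec \<Rightarrow> 'k mpol vec" where
  "truncate_free as P v = vec (length as) (\<lambda>j.
     Poly_Mapping.mapp (\<lambda>m c. c when P (mon_deg m + as ! j)) (v $ j))"

lemma lookup_truncate_free [simp]:
  "j < length as \<Longrightarrow> Poly_Mapping.lookup (truncate_free as P v $ j) m =
    (if P (mon_deg m + as ! j) then Poly_Mapping.lookup (v $ j) m else 0)"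
  by (auto simp: truncate_free_def lookup_mapp when_def in_keys_iff)

lemma truncate_free_dim [simp]: "dim_vec (truncate_free as P v) = length as"
  by (simp add: truncate_free_def)

lemma free_vec_eqI:
  assumes "dim_vec v = length as" "dim_vec w = length as"
    and "\<And>j m. j < length as \<Longrightarrow> Poly_Mapping.lookup (v $ j) m = Poly_Mapping.lookup (w $ j) m"
  shows "v = w"
  using assms by (intro eq_vecI poly_mapping_eqI) auto

lemma truncate_free_carrier:
  assumes v: "v \<in> carrier (free_mod n as)"
  shows "truncate_free as P v \<in> carrier (free_mod n as)"
proof -
  have "truncate_free as P v $ j \<in> carrier (poly_ring n)" if j: "j < length as" for j
    unfolding carrier_poly_ring
  proof
    fix m assume "m \<in> Poly_Mapping.keys (truncate_free as P v $ j)"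
    then have "m \<in> Poly_Mapping.keys (v $ j)"
      using j by (simp add: in_keys_iff split: if_splits)
    then show "Poly_Mapping.keys m \<subseteq> {1..n}"
      using v j unfolding free_mod_simps carrier_poly_ring by blast
  qed
  then show ?thesis
    by (auto intro: carrier_vecI)
qed

lemma truncate_free_in_free_part:
  "v \<in> carrier (free_mod n as) \<Longrightarrow> truncate_free as (\<lambda>t. t = s) v \<in> free_part n as s"
  unfolding free_part_iff using truncate_free_carrier by (fastforce split: if_splits)

lemma truncate_free_add:
  assumes "dim_vec v = length as" "dim_vec w = length as"
  shows "truncate_free as P (v + w) = truncate_free as P v + truncate_free as P w"
  by (rule free_vec_eqI[where as = as]) (use assms in \<open>auto simp: lookup_add\<close>)

lemma truncate_free_of_free_part:
  assumes "v \<in> free_part n as t"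
  shows "truncate_free as P v = (if P t then v else 0\<^sub>v (length as))"
  by (rule free_vec_eqI[where as = as]) (use assms in \<open>fastforce simp: free_part_iff\<close>)+

text \<open>Only finitely many total degrees occur in a vector, so an induction on the degree bound
  reaches the vector itself.\<close>

lemma ex_truncate_free_eq:
  assumes "v \<in> carrier (free_mod n as)"
  shows "\<exists>N. truncate_free as (\<lambda>t. t < N) v = v"
proof -
  let ?D = "\<Union>j<length as. (\<lambda>m. mon_deg m + as ! j) ` Poly_Mapping.keys (v $ j)"
  have "finite ?D" by auto
  then obtain N where N: "\<forall>t\<in>?D. t < N"
    using finite_nat_set_iff_bounded by blast
  have "truncate_free as (\<lambda>t. t < N) v = v"
    by (rule free_vec_eqI[where as = as]) (use assms N in \<open>fastforce simp: in_keys_iff\<close>)+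
  then show ?thesis ..
qed

text \<open>
  A degree-preserving map commutes with taking homogeneous components; the induction over the degree
  bound avoids summing over all components.
\<close>

lemma truncate_free_hom:
  fixes \<phi> :: "'k::field mpol vec \<Rightarrow> 'k mpol vec"
  assumes hom: "\<phi> \<in> LinearCombinations.module_hom (poly_ring n) (free_mod n as) (free_mod n bs)"
    and deg: "\<And>s. \<phi> ` free_part n as s \<subseteq> free_part n bs s"
    and v: "v \<in> carrier (free_mod n as)"
  shows "truncate_free bs (\<lambda>t. t = s) (\<phi> v) = \<phi> (truncate_free as (\<lambda>t. t = s) v)"
proof -
  interpret A: module "poly_ring n" "free_mod n as :: ('k mpol, 'k mpol vec) module"
    by (rule module_free_mod)
  interpret B: module "poly_ring n" "free_mod n bs :: ('k mpol, 'k mpol vec) module"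
    by (rule module_free_mod)
  interpret mod_hom "poly_ring n" "free_mod n as" "free_mod n bs" \<phi>
    using hom by unfold_locales
  have zero: "\<phi> (0\<^sub>v (length as)) = 0\<^sub>v (length bs)"
    using f0_is_0 by simp
  \<comment> \<open>On a vector of degree t both sides equal its image if \<open>t = s\<close>, and
    zero otherwise.\<close>
  have single: "truncate_free bs (\<lambda>t. t = s) (\<phi> w) = \<phi> (truncate_free as (\<lambda>t. t = s) w)"
    if "w \<in> free_part n as t" for w t
    using that deg[of t] zero truncate_free_of_free_part[OF that]
      truncate_free_of_free_part[of "\<phi> w" n bs t]
    by auto
  have "truncate_free bs (\<lambda>t. t = s) (\<phi> (truncate_free as (\<lambda>t. t < N) v)) =
      \<phi> (truncate_free as (\<lambda>t. t = s) (truncate_free as (\<lambda>t. t < N) v))" for N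
  proof (induction N)
    case 0
    have "truncate_free as (\<lambda>t. t < 0) v = 0\<^sub>v (length as)"
      by (rule free_vec_eqI[where as = as]) auto
    then show ?case
      using single[of "0\<^sub>v (length as)" 0] by (simp add: free_part_iff)
  next
    case (Suc N)
    let ?w = "truncate_free as (\<lambda>t. t < N) v" and ?u = "truncate_free as (\<lambda>t. t = N) v"
    have w: "?w \<in> carrier (free_mod n as)" and u: "?u \<in> free_part n as N" "?u \<in> carrier (free_mod n as)"
      using v by (auto intro: truncate_free_carrier truncate_free_in_free_part simp del: free_mod_simps)
    \<comment> \<open>Raising the bound by one adds exactly the component of degree N, to which
      \<open>single\<close> applies.\<close>
    have eq: "truncate_free as (\<lambda>t. t < Suc N) v = ?w + ?u"
      by (rule free_vec_eqI[where as = as]) (auto simp: lookup_add)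
    have closed: "\<phi> x \<in> carrier (free_mod n bs)" if "x \<in> carrier (free_mod n as)" for x
      using that by (rule f_im)
    have add: "\<phi> (x + y) = \<phi> x + \<phi> y" if "x \<in> carrier (free_mod n as)" "y \<in> carrier (free_mod n as)" for x y
      using f_add[OF that] by simp
    show ?case
      unfolding eq add[OF w u(2)]
      using closed[OF w] closed[OF u(2)] truncate_free_carrier[OF w] truncate_free_carrier[OF u(2)]
      by (simp add: truncate_free_add Suc single[OF u(1)] add del: free_mod_simps(1))
        (simp add: truncate_free_add Suc single[OF u(1)])
  qed
  then show ?thesis
    using ex_truncate_free_eq[OF v] by metis
qed

text \<open>If an image is homogeneous of degree \<open>s\<close>, the degree-\<open>s\<close>
  component of any preimage has the same image. Exactness of the resolution thereby passes to each
  degree.\<close>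

lemma graded_image:
  fixes \<phi> :: "'k::field mpol vec \<Rightarrow> 'k mpol vec"
  assumes hom: "\<phi> \<in> LinearCombinations.module_hom (poly_ring n) (free_mod n as) (free_mod n bs)"
    and deg: "\<And>s. \<phi> ` free_part n as s \<subseteq> free_part n bs s"
  shows "\<phi> ` carrier (free_mod n as) \<inter> free_part n bs s = \<phi> ` free_part n as s"
proof (intro equalityI subsetI)
  fix w assume "w \<in> \<phi> ` carrier (free_mod n as) \<inter> free_part n bs s"
  then obtain v where v: "v \<in> carrier (free_mod n as)" "w = \<phi> v" "w \<in> free_part n bs s"
    by blast
  then have "w = truncate_free bs (\<lambda>t. t = s) (\<phi> v)"
    by (simp add: truncate_free_of_free_part)
  also have "\<dots> = \<phi> (truncate_free as (\<lambda>t. t = s) v)"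
    by (rule truncate_free_hom[OF hom deg v(1)])
  finally show "w \<in> \<phi> ` free_part n as s"
    using truncate_free_in_free_part[OF v(1)] by blast
next
  fix w assume "w \<in> \<phi> ` free_part n as s"
  then show "w \<in> \<phi> ` carrier (free_mod n as) \<inter> free_part n bs s"
    using deg free_part_subset by blast
qed

section \<open>The Stanley-Reisner ring\<close>

definition face_coset :: "nat \<Rightarrow> nat set set \<Rightarrow> 'k::field mpol \<Rightarrow> 'k mpol set" where
  "face_coset n \<Delta> p = sr_ideal n \<Delta> +>\<^bsub>poly_ring n\<^esub> p"

lemma simplicial_complex_finite:
  assumes "simplicial_complex n \<Delta>"
  shows "finite \<Delta>" "F \<in> \<Delta> \<Longrightarrow> finite F" "F \<in> \<Delta> \<Longrightarrow> card F \<le> n"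
proof -
  have sub: "\<Delta> \<subseteq> Pow {1..n}"
    using assms by (auto simp: simplicial_complex_def)
  then show "finite \<Delta>" "F \<in> \<Delta> \<Longrightarrow> finite F"
    using finite_subset by blast+
  show "F \<in> \<Delta> \<Longrightarrow> card F \<le> n"
    using sub card_mono[of "{1..n}" F] by auto
qed

section \<open>The Stanley-Reisner ideal as the span of the nonface monomials\<close>

lemma poly_mapping_eq_sum_single:
  "p = (\<Sum>m\<in>Poly_Mapping.keys p. Poly_Mapping.single m (Poly_Mapping.lookup p m))"
  by (rule poly_mapping_eqI)
    (auto simp: lookup_sum lookup_single when_def in_keys_iff sum.delta)

lemma prod_var_eq_single:
  assumes "finite F"
  shows "(\<Prod>i\<in>F. var i :: 'k::field mpol) = Poly_Mapping.single (\<Sum>i\<in>F. Poly_Mapping.single i (Suc 0)) 1"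
  using assms by (induction F rule: finite_induct) (simp_all add: var_def mult_single)

lemma lookup_sum_single:
  assumes "finite F"
  shows "Poly_Mapping.lookup (\<Sum>i\<in>F. Poly_Mapping.single i (Suc 0)) j = (if j \<in> F then 1 else 0)"
  using assms by (simp add: lookup_sum lookup_single when_def)

lemma keys_sum_single:
  assumes "finite F"
  shows "Poly_Mapping.keys (\<Sum>i\<in>F. Poly_Mapping.single i (Suc 0)) = F"
  using assms by (auto simp: in_keys_iff lookup_sum_single split: if_splits)

text \<open>Multiplication can only enlarge the support of a monomial, and a superset of a nonface
  is a nonface because \<Delta> is closed under subsets.\<close>

lemma ideal_nonface_polys:
  assumes "simplicial_complex n \<Delta>"
  shows "ideal {p \<in> carrier (poly_ring n). \<forall>m\<in>Poly_Mapping.keys p. Poly_Mapping.keys m \<notin> \<Delta>}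
    (poly_ring n :: 'k::field mpol ring)" (is "ideal ?J _")
proof -
  interpret R: cring "poly_ring n :: 'k mpol ring"
    by (rule cring_poly_ring)
  have uminus: "\<ominus>\<^bsub>poly_ring n\<^esub> p = - p" if "p \<in> carrier (poly_ring n)" for p :: "'k mpol"
    using that by (intro R.minus_equality) simp_all
  have mult: "q * p \<in> ?J" if "p \<in> ?J" "q \<in> carrier (poly_ring n)" for p q :: "'k mpol"
  proof -
    have "Poly_Mapping.keys m \<notin> \<Delta>" if "m \<in> Poly_Mapping.keys (q * p)" for m
    proof -
      obtain a b where "m = a + b" "b \<in> Poly_Mapping.keys p"
        using \<open>m \<in> Poly_Mapping.keys (q * p)\<close> keys_mult[of q p] by blast
      then have "Poly_Mapping.keys b \<notin> \<Delta>" "Poly_Mapping.keys b \<subseteq> Poly_Mapping.keys m"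
        using \<open>p \<in> ?J\<close> by (auto simp: keys_add_nat)
      then show ?thesis
        using assms unfolding simplicial_complex_def by blast
    qed
    then show ?thesis
      using that by simp
  qed
  show ?thesis
  proof (rule idealI)
    show "subgroup ?J (add_monoid (poly_ring n))"
    proof (rule R.add.subgroupI)
      show "\<ominus>\<^bsub>poly_ring n\<^esub> p \<in> ?J" if "p \<in> ?J" for p
        using that by (simp add: uminus)
      show "p \<oplus>\<^bsub>poly_ring n\<^esub> q \<in> ?J" if "p \<in> ?J" "q \<in> ?J" for p q
        using that keys_add[of p q] by auto
      have "0 \<in> ?J" by simp
      then show "?J \<noteq> {}" by blast
    qed blast
    show "q \<otimes>\<^bsub>poly_ring n\<^esub> p \<in> ?J" "p \<otimes>\<^bsub>poly_ring n\<^esub> q \<in> ?J" if "p \<in> ?J" "q \<in> carrier (poly_ring n)" for p q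
      using mult[OF that] by (simp_all add: mult.commute)
  qed (rule R.ring_axioms)
qed

lemma nonface_generators_closed:
  assumes "F \<subseteq> {1..n}"
  shows "(\<Prod>i\<in>F. var i :: 'k::field mpol) \<in> carrier (poly_ring n)"
proof -
  have "finite F" using assms finite_subset by blast
  then show ?thesis
    using assms by (simp add: prod_var_eq_single carrier_poly_ring keys_sum_single)
qed

lemma ideal_sr_ideal: "ideal (sr_ideal n \<Delta> :: 'k::field mpol set) (poly_ring n)"
proof -
  interpret R: cring "poly_ring n :: 'k mpol ring"
    by (rule cring_poly_ring)
  show ?thesis
    unfolding sr_ideal_def
    by (rule R.genideal_ideal) (use nonface_generators_closed in blast)
qed

text \<open>A monomial is divisible by the squarefree monomial on its support, which is a generator
  when the support is not a face.\<close>

lemma single_in_sr_ideal: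
  assumes "Poly_Mapping.keys m \<subseteq> {1..n}" "Poly_Mapping.keys m \<notin> \<Delta>"
  shows "Poly_Mapping.single m c \<in> (sr_ideal n \<Delta> :: 'k::field mpol set)"
proof -
  interpret R: cring "poly_ring n :: 'k mpol ring"
    by (rule cring_poly_ring)
  interpret I: ideal "sr_ideal n \<Delta> :: 'k mpol set" "poly_ring n"
    by (rule ideal_sr_ideal)
  let ?F = "Poly_Mapping.keys m"
  let ?e = "\<Sum>i\<in>?F. Poly_Mapping.single i (Suc 0)"
  have "m - ?e + ?e = m"
    by (rule poly_mapping_eqI) (auto simp: lookup_add lookup_minus lookup_sum_single in_keys_iff)
  then have eq: "Poly_Mapping.single m c = Poly_Mapping.single (m - ?e) c * (\<Prod>i\<in>?F. var i)"
    by (simp add: prod_var_eq_single mult_single)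
  have "Poly_Mapping.keys (m - ?e) \<subseteq> {1..n}"
    using assms(1) by (auto simp: in_keys_iff lookup_minus subset_iff simp del: atLeastAtMost_iff)
  then have "Poly_Mapping.single (m - ?e) c \<in> carrier (poly_ring n)"
    by (simp add: carrier_poly_ring)
  moreover have "{\<Prod>i\<in>F. var i |F. F \<subseteq> {1..n} \<and> F \<notin> \<Delta>} \<subseteq> (sr_ideal n \<Delta> :: 'k mpol set)"
    unfolding sr_ideal_def by (rule R.genideal_self) (use nonface_generators_closed in blast)
  then have "(\<Prod>i\<in>?F. var i) \<in> (sr_ideal n \<Delta> :: 'k mpol set)"
    using assms by blast
  ultimately show ?thesis
    unfolding eq using I.I_l_closed by fastforce
qed

lemma sr_ideal_eq:
  assumes "simplicial_complex n \<Delta>"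
  shows "(sr_ideal n \<Delta> :: 'k::field mpol set) =
    {p \<in> carrier (poly_ring n). \<forall>m\<in>Poly_Mapping.keys p. Poly_Mapping.keys m \<notin> \<Delta>}" (is "_ = ?J")
proof (intro equalityI subsetI)
  interpret R: cring "poly_ring n :: 'k mpol ring"
    by (rule cring_poly_ring)
  interpret I: ideal "sr_ideal n \<Delta> :: 'k mpol set" "poly_ring n"
    by (rule ideal_sr_ideal)
  have "{\<Prod>i\<in>F. var i |F. F \<subseteq> {1..n} \<and> F \<notin> \<Delta>} \<subseteq> ?J"
  proof
    fix p :: "'k mpol" assume "p \<in> {\<Prod>i\<in>F. var i |F. F \<subseteq> {1..n} \<and> F \<notin> \<Delta>}"
    then obtain F where F: "p = (\<Prod>i\<in>F. var i)" "F \<subseteq> {1..n}" "F \<notin> \<Delta>" "finite F"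
      using finite_subset by blast
    then show "p \<in> ?J"
      using nonface_generators_closed[OF F(2)] by (simp add: prod_var_eq_single keys_sum_single)
  qed
  then have "sr_ideal n \<Delta> \<subseteq> ?J"
    unfolding sr_ideal_def by (rule R.genideal_minimal[OF ideal_nonface_polys[OF assms]])
  then show "p \<in> ?J" if "p \<in> sr_ideal n \<Delta>" for p
    using that by (rule subsetD)
  show "p \<in> sr_ideal n \<Delta>" if p: "p \<in> ?J" for p
  proof -
    \<comment> \<open>Each term of p lies in the ideal; closure under binary sums is extended to the
      whole of p through partial sums over sets A of its monomials.\<close>
    have "(\<Sum>m\<in>A. Poly_Mapping.single m (Poly_Mapping.lookup p m)) \<in> sr_ideal n \<Delta>"
      if "finite A" "A \<subseteq> Poly_Mapping.keys p" for A
      using that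
    proof (induction A rule: finite_induct)
      case empty
      show ?case using I.zero_closed by simp
    next
      case (insert m A)
      have "Poly_Mapping.single m (Poly_Mapping.lookup p m) \<in> sr_ideal n \<Delta>"
        using insert.prems p by (intro single_in_sr_ideal) (simp_all add: carrier_poly_ring)
      then show ?case
        using insert I.a_closed by fastforce
    qed
    then show ?thesis
      by (subst poly_mapping_eq_sum_single) simp
  qed
qed

section \<open>k[\<Delta>] as a graded module\<close>

lemma face_coset_hom: "face_coset n \<Delta> \<in> Ring.ring_hom (poly_ring n :: 'k::field mpol ring) (sr_ring n \<Delta>)"
  using ideal.rcos_ring_hom[OF ideal_sr_ideal[of n \<Delta>]]
  by (simp add: face_coset_def[abs_def] sr_ring_def)

lemma ring_sr_ring: "cring (sr_ring n \<Delta> :: 'k::field mpol set ring)"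
  unfolding sr_ring_def
  by (rule ideal.quotient_is_cring[OF ideal_sr_ideal cring_poly_ring])

lemma carrier_sr_ring: "carrier (sr_ring n \<Delta> :: 'k::field mpol set ring) = face_coset n \<Delta> ` carrier (poly_ring n)"
  by (auto simp: sr_ring_def FactRing_def A_RCOSETS_def' face_coset_def)

lemma sr_module_simps [simp]:
  "carrier (sr_module n \<Delta> :: ('k::field mpol, 'k mpol set) module) = face_coset n \<Delta> ` carrier (poly_ring n)"
  "add (sr_module n \<Delta> :: ('k mpol, 'k mpol set) module) = add (sr_ring n \<Delta>)"
  "zero (sr_module n \<Delta> :: ('k mpol, 'k mpol set) module) = zero (sr_ring n \<Delta>)"
  "smult (sr_module n \<Delta> :: ('k mpol, 'k mpol set) module) = (\<lambda>r X. face_coset n \<Delta> r \<otimes>\<^bsub>sr_ring n \<Delta>\<^esub> X)"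
  by (simp_all add: sr_module_def carrier_sr_ring face_coset_def[abs_def])

lemma face_coset_simps:
  fixes p q :: "'k::field mpol"
  assumes "p \<in> carrier (poly_ring n)" "q \<in> carrier (poly_ring n)"
  shows "face_coset n \<Delta> p \<oplus>\<^bsub>sr_ring n \<Delta>\<^esub> face_coset n \<Delta> q = face_coset n \<Delta> (p + q)"
    "face_coset n \<Delta> p \<otimes>\<^bsub>sr_ring n \<Delta>\<^esub> face_coset n \<Delta> q = face_coset n \<Delta> (p * q)"
  using ring_hom_add[OF face_coset_hom assms] ring_hom_mult[OF face_coset_hom assms] by simp_all

lemma face_coset_0: "\<zero>\<^bsub>sr_ring n \<Delta>\<^esub> = face_coset n \<Delta> (0 :: 'k::field mpol)"
  using ring_hom_zero[OF face_coset_hom[of n \<Delta>] cring.axioms(1)[OF cring_poly_ring]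
      cring.axioms(1)[OF ring_sr_ring]]
  unfolding poly_ring_simps by (rule sym)

lemma face_coset_1: "\<one>\<^bsub>sr_ring n \<Delta>\<^esub> = face_coset n \<Delta> (1 :: 'k::field mpol)"
  using ring_hom_one[OF face_coset_hom[of n \<Delta>]] unfolding poly_ring_simps by (rule sym)

lemma module_sr_module: "module (poly_ring n) (sr_module n \<Delta> :: ('k::field mpol, 'k mpol set) module)"
proof (rule moduleI)
  interpret Q: cring "sr_ring n \<Delta> :: 'k mpol set ring"
    by (rule ring_sr_ring)
  note carr = carrier_sr_ring[of n \<Delta>, where 'k = 'k, symmetric]
  have closed: "face_coset n \<Delta> p \<in> carrier (sr_ring n \<Delta>)" if "p \<in> carrier (poly_ring n)" for p :: "'k mpol"
    using that by (simp add: carrier_sr_ring)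
  show "cring (poly_ring n :: 'k mpol ring)"
    by (rule cring_poly_ring)
  show "abelian_group (sr_module n \<Delta> :: ('k mpol, 'k mpol set) module)"
    by (rule abelian_groupI)
      (auto simp: carr Q.a_ac intro: Q.l_neg bexI[of _ "\<ominus>\<^bsub>sr_ring n \<Delta>\<^esub> _"])
  fix a b :: "'k mpol" and x y :: "'k mpol set"
  assume a: "a \<in> carrier (poly_ring n)" and x: "x \<in> carrier (sr_module n \<Delta>)"
  show "a \<odot>\<^bsub>sr_module n \<Delta>\<^esub> x \<in> carrier (sr_module n \<Delta>)"
    using a x closed by (simp add: carr)
  show "a \<odot>\<^bsub>sr_module n \<Delta>\<^esub> (x \<oplus>\<^bsub>sr_module n \<Delta>\<^esub> y) =
      a \<odot>\<^bsub>sr_module n \<Delta>\<^esub> x \<oplus>\<^bsub>sr_module n \<Delta>\<^esub> a \<odot>\<^bsub>sr_module n \<Delta>\<^esub> y"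
    if "y \<in> carrier (sr_module n \<Delta>)"
    using a x that closed by (simp add: carr Q.r_distr)
  assume b: "b \<in> carrier (poly_ring n)"
  show "(a \<oplus>\<^bsub>poly_ring n\<^esub> b) \<odot>\<^bsub>sr_module n \<Delta>\<^esub> x =
      a \<odot>\<^bsub>sr_module n \<Delta>\<^esub> x \<oplus>\<^bsub>sr_module n \<Delta>\<^esub> b \<odot>\<^bsub>sr_module n \<Delta>\<^esub> x"
    using a b x closed by (simp add: carr Q.l_distr flip: face_coset_simps(1))
  show "(a \<otimes>\<^bsub>poly_ring n\<^esub> b) \<odot>\<^bsub>sr_module n \<Delta>\<^esub> x =
      a \<odot>\<^bsub>sr_module n \<Delta>\<^esub> (b \<odot>\<^bsub>sr_module n \<Delta>\<^esub> x)"
    using a b x closed by (simp add: carr Q.m_assoc flip: face_coset_simps(2))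
next
  interpret Q: cring "sr_ring n \<Delta> :: 'k mpol set ring"
    by (rule ring_sr_ring)
  show "\<one>\<^bsub>poly_ring n\<^esub> \<odot>\<^bsub>sr_module n \<Delta>\<^esub> x = x" if "x \<in> carrier (sr_module n \<Delta>)" for x :: "'k mpol set"
    using that by (simp add: flip: face_coset_1 carrier_sr_ring)
qed

lemma homog_poly_iff:
  "p \<in> homog_poly n s \<longleftrightarrow> p \<in> carrier (poly_ring n) \<and> (\<forall>m. Poly_Mapping.lookup p m \<noteq> 0 \<longrightarrow> mon_deg m = s)"
  by (auto simp: homog_poly_def in_keys_iff)

lemma sr_part_eq: "sr_part n \<Delta> s = face_coset n \<Delta> ` homog_poly n s"
  by (simp add: sr_part_def face_coset_def)

lemma homog_poly_add: "p \<in> homog_poly n s \<Longrightarrow> q \<in> homog_poly n s \<Longrightarrow> p + q \<in> homog_poly n s"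
  by (auto simp: homog_poly_iff lookup_add) (metis add_0)

lemma homog_poly_const_mult: "p \<in> homog_poly n s \<Longrightarrow> const c * p \<in> homog_poly n s"
  by (auto simp: homog_poly_iff)

lemma homog_poly_subset: "homog_poly n s \<subseteq> carrier (poly_ring n)"
  by (auto simp: homog_poly_iff)

lemma vectorspace_sr_part:
  "vectorspace class_ring (graded_piece (sr_module n \<Delta> :: ('k::field mpol, 'k mpol set) module) (sr_part n \<Delta>) s)"
proof (rule vectorspace_graded_piece[OF module_sr_module])
  show "sr_part n \<Delta> s \<subseteq> carrier (sr_module n \<Delta> :: ('k mpol, 'k mpol set) module)"
    using homog_poly_subset by (auto simp: sr_part_eq)
  have "(0 :: 'k mpol) \<in> homog_poly n s"
    by (simp add: homog_poly_iff)
  then show "\<zero>\<^bsub>sr_module n \<Delta>\<^esub> \<in> (sr_part n \<Delta> s :: 'k mpol set set)"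
    by (simp add: sr_part_eq face_coset_0)
  fix x y :: "'k mpol set" and c :: 'k
  assume "x \<in> sr_part n \<Delta> s"
  then obtain p where p: "x = face_coset n \<Delta> p" "p \<in> homog_poly n s" "p \<in> carrier (poly_ring n)"
    using homog_poly_subset by (auto simp: sr_part_eq)
  show "const c \<odot>\<^bsub>sr_module n \<Delta>\<^esub> x \<in> sr_part n \<Delta> s"
    using p homog_poly_const_mult[OF p(2), of c] by (simp add: sr_part_eq face_coset_simps)
  assume "y \<in> sr_part n \<Delta> s"
  then obtain q where q: "y = face_coset n \<Delta> q" "q \<in> homog_poly n s" "q \<in> carrier (poly_ring n)"
    using homog_poly_subset by (auto simp: sr_part_eq)
  show "x \<oplus>\<^bsub>sr_module n \<Delta>\<^esub> y \<in> sr_part n \<Delta> s"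
    using p q homog_poly_add[OF p(2) q(2)] by (simp add: sr_part_eq face_coset_simps)
qed

text \<open>The difference of p and q involves nonface monomials only. Together with
  \<open>face_coset_lookup\<close>, a class is determined precisely by its coefficients on face
  monomials.\<close>

lemma face_coset_eqI:
  assumes "simplicial_complex n \<Delta>" "p \<in> carrier (poly_ring n)" "q \<in> carrier (poly_ring n)"
    and eq: "\<And>m. Poly_Mapping.keys m \<in> \<Delta> \<Longrightarrow> Poly_Mapping.lookup p m = Poly_Mapping.lookup q m"
  shows "face_coset n \<Delta> p = face_coset n \<Delta> (q :: 'k::field mpol)"
proof -
  interpret I: ideal "sr_ideal n \<Delta> :: 'k mpol set" "poly_ring n"
    by (rule ideal_sr_ideal)
  have "p + (- q) \<in> carrier (poly_ring n)"
    using assms by (intro poly_ring_closed)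
  then have "p - q \<in> sr_ideal n \<Delta>"
    using eq unfolding sr_ideal_eq[OF assms(1)] by (auto simp: in_keys_iff lookup_minus)
  then have "p \<in> face_coset n \<Delta> q"
    unfolding face_coset_def a_r_coset_def' by (auto intro!: bexI[of _ "p - q"])
  then show ?thesis
    unfolding face_coset_def using I.a_repr_independence'[of p q] assms by simp
qed

lemma face_coset_lookup:
  assumes "simplicial_complex n \<Delta>" "q \<in> face_coset n \<Delta> p" "Poly_Mapping.keys m \<in> \<Delta>"
  shows "Poly_Mapping.lookup q m = Poly_Mapping.lookup (p :: 'k::field mpol) m"
  using assms unfolding face_coset_def a_r_coset_def' sr_ideal_eq[OF assms(1)]
  by (auto simp: lookup_add in_keys_iff)

lemma dim_sr_part:
  assumes sc: "simplicial_complex n \<Delta>"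
  defines "V \<equiv> \<lambda>s. graded_piece (sr_module n \<Delta> :: ('k::field mpol, 'k mpol set) module) (sr_part n \<Delta>) s"
  shows "vectorspace.dim class_ring (V s) = card (monomials \<Delta> s)"
proof -
  interpret I: ideal "sr_ideal n \<Delta> :: 'k mpol set" "poly_ring n"
    by (rule ideal_sr_ideal)
  txt \<open>On face monomials the coefficients do not depend on the representative of the coset.\<close>
  define coord :: "'k mpol set \<Rightarrow> (nat \<Rightarrow>\<^sub>0 nat) \<Rightarrow> 'k"
    where "coord = (\<lambda>X m. Poly_Mapping.lookup (SOME p. p \<in> X) m)"
  have fin: "finite (monomials \<Delta> s)"
    using simplicial_complex_finite[OF sc] by (intro finite_monomials)
  have coord: "coord (face_coset n \<Delta> p) m = Poly_Mapping.lookup p m"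
    if "p \<in> carrier (poly_ring n)" "m \<in> monomials \<Delta> s" for p m
  proof -
    have "p \<in> face_coset n \<Delta> p"
      unfolding face_coset_def by (rule I.a_rcos_self[OF that(1)])
    then have "(SOME q. q \<in> face_coset n \<Delta> p) \<in> face_coset n \<Delta> p"
      by (rule someI)
    then show ?thesis
      unfolding coord_def using face_coset_lookup[OF sc] that(2) by (auto simp: monomials_def)
  qed
  have carr: "\<exists>p. x = face_coset n \<Delta> p \<and> p \<in> homog_poly n s \<and> p \<in> carrier (poly_ring n)"
    if "x \<in> carrier (V s)" for x
    using that homog_poly_subset by (auto simp: V_def graded_piece_def sr_part_eq)
  have ops: "x \<oplus>\<^bsub>V s\<^esub> y = x \<oplus>\<^bsub>sr_ring n \<Delta>\<^esub> y" "c \<odot>\<^bsub>V s\<^esub> x = face_coset n \<Delta> (const c) \<otimes>\<^bsub>sr_ring n \<Delta>\<^esub> x"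
    for x y c
    by (simp_all add: V_def graded_piece_def)
  show ?thesis
  proof (rule dim_by_coordinates[where coord = coord])
    show "vectorspace class_ring (V s)"
      unfolding V_def by (rule vectorspace_sr_part)
    show "finite (monomials \<Delta> s)" by fact
  next
    fix x y m assume "x \<in> carrier (V s)" "y \<in> carrier (V s)" "m \<in> monomials \<Delta> s"
    then show "coord (x \<oplus>\<^bsub>V s\<^esub> y) m = coord x m + coord y m"
      using carr[of x] carr[of y] by (auto simp: ops face_coset_simps coord lookup_add)
  next
    fix x m c assume "x \<in> carrier (V s)" "m \<in> monomials \<Delta> s"
    then show "coord (c \<odot>\<^bsub>V s\<^esub> x) m = c * coord x m"
      using carr[of x] by (auto simp: ops face_coset_simps coord)
  next
    fix x y assume xy: "x \<in> carrier (V s)" "y \<in> carrier (V s)"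
      and eq: "\<And>m. m \<in> monomials \<Delta> s \<Longrightarrow> coord x m = coord y m"
    obtain p q where p: "x = face_coset n \<Delta> p" "p \<in> homog_poly n s" "p \<in> carrier (poly_ring n)"
      and q: "y = face_coset n \<Delta> q" "q \<in> homog_poly n s" "q \<in> carrier (poly_ring n)"
      using carr[OF xy(1)] carr[OF xy(2)] by blast
    show "x = y"
      unfolding p(1) q(1)
    proof (rule face_coset_eqI[OF sc p(3) q(3)])
      fix m :: "nat \<Rightarrow>\<^sub>0 nat" assume m: "Poly_Mapping.keys m \<in> \<Delta>"
      show "Poly_Mapping.lookup p m = Poly_Mapping.lookup q m"
      \<comment> \<open>The coordinates see only degree \<open>s\<close>; in other degrees both
        representatives have coefficient 0 by homogeneity.\<close>
      proof (cases "mon_deg m = s")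
        case True
        then have "m \<in> monomials \<Delta> s" using m by (simp add: monomials_def)
        then show ?thesis using eq[of m] coord p(1,3) q(1,3) by simp
      next
        case False
        then show ?thesis using p(2) q(2) unfolding homog_poly_iff by metis
      qed
    qed
  next
    fix f :: "(nat \<Rightarrow>\<^sub>0 nat) \<Rightarrow> 'k"
    obtain p where p: "\<And>m. Poly_Mapping.lookup p m = (if m \<in> monomials \<Delta> s then f m else 0)"
      using ex_poly_mapping[OF fin, of f] by blast
    have nz: "Poly_Mapping.keys m \<subseteq> {1..n} \<and> mon_deg m = s" if "Poly_Mapping.lookup p m \<noteq> 0" for m
      using that sc by (simp add: p monomials_def simplicial_complex_def split: if_splits)
    then have "p \<in> carrier (poly_ring n)"
      by (simp add: carrier_poly_ring in_keys_iff)
    moreover from this have "face_coset n \<Delta> p \<in> carrier (V s)"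
      using nz by (auto simp: V_def graded_piece_def sr_part_eq homog_poly_iff)
    ultimately show "\<exists>x\<in>carrier (V s). \<forall>m\<in>monomials \<Delta> s. coord x m = f m"
      by (intro bexI[of _ "face_coset n \<Delta> p"]) (simp_all add: coord p)
  qed
qed

lemma hilbert_series_sr_module:
  assumes "simplicial_complex n \<Delta>"
  shows "hilbert_series (sr_module n \<Delta> :: ('k::field mpol, 'k mpol set) module) (sr_part n \<Delta>) = monomials_fps \<Delta>"
  by (rule fps_ext) (simp add: hilbert_series_def monomials_fps_def dim_sr_part[OF assms])

section \<open>Hilbert series along a resolution\<close>

lemma linear_map_graded_piece:
  fixes M :: "('k::field mpol, 'a) module" and N :: "('k mpol, 'b) module"
  assumes hom: "f \<in> LinearCombinations.module_hom (poly_ring n) M N"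
    and sub: "G s \<subseteq> carrier M" and deg: "f ` G s \<subseteq> H s"
    and V: "vectorspace class_ring (graded_piece M G s)"
    and W: "vectorspace class_ring (graded_piece N H s)"
  shows "linear_map class_ring (graded_piece M G s) (graded_piece N H s) f"
proof -
  have "f \<in> LinearCombinations.module_hom class_ring (graded_piece M G s) (graded_piece N H s)"
    using hom sub deg unfolding module_hom_def graded_piece_def
    by (auto simp: subset_iff)
  then show ?thesis
    using V W by (intro linear_map.intro mod_hom.intro mod_hom_axioms.intro) (simp_all add: vectorspace_def)
qed

text \<open>Image and kernel are written as pieces of N and M with their own component families, so
  that exactness can be inserted later as a plain equality of sets.\<close>

lemma rank_nullity_graded_piece:
  fixes M :: "('k::field mpol, 'a) module" and N :: "('k mpol, 'b) module"
  assumes hom: "f \<in> LinearCombinations.module_hom (poly_ring n) M N"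
    and sub: "G s \<subseteq> carrier M" and deg: "f ` G s \<subseteq> H s"
    and V: "vectorspace class_ring (graded_piece M G s)"
    and W: "vectorspace class_ring (graded_piece N H s)"
    and fd: "vectorspace.fin_dim class_ring (graded_piece M G s)"
  shows "vectorspace.dim (class_ring :: 'k ring) (graded_piece N (\<lambda>s. f ` G s) s) +
    vectorspace.dim (class_ring :: 'k ring) (graded_piece M (\<lambda>s. {x \<in> G s. f x = \<zero>\<^bsub>N\<^esub>}) s) =
    vectorspace.dim (class_ring :: 'k ring) (graded_piece M G s)"
proof -
  interpret linear_map class_ring "graded_piece M G s" "graded_piece N H s" f
    by (rule linear_map_graded_piece[OF hom sub deg V W])
  have "im = f ` G s" "ker = {x \<in> G s. f x = \<zero>\<^bsub>N\<^esub>}"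
    unfolding im_def ker_def by (simp_all add: graded_piece_def)
  then show ?thesis
    using rank_nullity[OF fd] by (simp add: graded_piece_def)
qed

lemma dim_trivial_piece:
  fixes M :: "('k::field mpol, 'm) module"
  assumes "module (poly_ring n) M"
  shows "vectorspace.dim (class_ring :: 'k ring) (graded_piece M (\<lambda>s. {\<zero>\<^bsub>M\<^esub>}) s) = 0"
proof -
  interpret M: module "poly_ring n" M by fact
  have "vectorspace class_ring (graded_piece M (\<lambda>s. {\<zero>\<^bsub>M\<^esub>}) s)"
    by (rule vectorspace_graded_piece[OF assms]) (auto intro: M.smult_r_null)
  \<comment> \<open>The zero space has coordinates indexed by the empty set.\<close>
  then have "vectorspace.dim class_ring (graded_piece M (\<lambda>s. {\<zero>\<^bsub>M\<^esub>}) s) = card ({} :: nat set)"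
    by (rule dim_by_coordinates(2)) (auto simp: graded_piece_def)
  then show ?thesis by simp
qed

text \<open>In the application \<open>v i\<close> is the dimension of the i-th free module in a
  fixed degree and \<open>r i\<close> that of the incoming image, which is also the outgoing kernel.
  Each intermediate \<open>r i\<close> occurs twice, with opposite signs.\<close>

lemma alternating_sum_telescope:
  fixes r v :: "nat \<Rightarrow> int"
  assumes "\<And>i. i < L \<Longrightarrow> v (Suc i) = r i + r (Suc i)"
  shows "(\<Sum>i<L. (-1) ^ Suc i * v (Suc i)) = (-1) ^ L * r L - r 0"
  using assms by (induction L) (auto simp: algebra_simps)

text \<open>Rank-nullity for \<epsilon> measures its image, so the image has to be all of
  \<open>G s\<close>; the assumption \<open>surj\<close> provides this where the resolution itself
  records only an inclusion.\<close>

lemma hilbert_series_resolution: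
  fixes M :: "('k::field mpol, 'm) module"
  assumes res: "graded_free_resolution n M G L a \<phi> \<epsilon>"
    and VM: "\<And>s. vectorspace class_ring (graded_piece M G s)"
    and surj: "\<And>s. \<epsilon> ` free_part n (a 0) s = G s"
  shows "hilbert_series M G =
    (\<Sum>i\<le>L. (-1) ^ i * hilbert_series (free_mod n (a i) :: ('k mpol, 'k mpol vec) module) (free_part n (a i)))"
proof (rule fps_ext)
  fix s
  let ?F = "\<lambda>i. free_mod n (a i) :: ('k mpol, 'k mpol vec) module"
  let ?P = "\<lambda>i. free_part n (a i) :: nat \<Rightarrow> 'k mpol vec set"
  let ?dim = "vectorspace.dim (class_ring :: 'k ring)"
  \<comment> \<open>\<open>K i t\<close> is the degree-\<open>t\<close> part of the image arriving
    in \<open>?F i\<close>, zero at the last module. By exactness it is also the kernel of the map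
    leaving \<open>?F i\<close>, so \<open>r i\<close> enters the rank formulas of two consecutive
    maps.\<close>
  define K where "K = (\<lambda>i t. if i < L then \<phi> i ` ?P (Suc i) t else {\<zero>\<^bsub>?F i\<^esub>})"
  define r where "r = (\<lambda>i. ?dim (graded_piece (?F i) (K i) s))"
  have hom0: "\<epsilon> \<in> LinearCombinations.module_hom (poly_ring n) (?F 0) M"
    and hom: "\<And>i. i < L \<Longrightarrow> \<phi> i \<in> LinearCombinations.module_hom (poly_ring n) (?F (Suc i)) (?F i)"
    and deg: "\<And>i s. i < L \<Longrightarrow> \<phi> i ` ?P (Suc i) s \<subseteq> ?P i s"
    and ker0: "a_kernel (?F 0) M \<epsilon> = (if 0 < L then \<phi> 0 ` carrier (?F 1) else {\<zero>\<^bsub>?F 0\<^esub>})"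
    and ker: "\<And>i. i < L \<Longrightarrow> a_kernel (?F (Suc i)) (?F i) (\<phi> i) =
      (if Suc i < L then \<phi> (Suc i) ` carrier (?F (Suc (Suc i))) else {\<zero>\<^bsub>?F (Suc i)\<^esub>})"
    using res unfolding graded_free_resolution_def Let_def by simp_all
  have zero: "\<zero>\<^bsub>?F i\<^esub> \<in> ?P i t" for i t
    by (simp add: free_part_iff)
  have K: "(if i < L then \<phi> i ` carrier (?F (Suc i)) else {\<zero>\<^bsub>?F i\<^esub>}) \<inter> ?P i t = K i t" for i t
    using graded_image[OF hom deg, of i t] by (auto simp: K_def zero simp del: free_mod_simps)
  have "{x \<in> ?P 0 t. \<epsilon> x = \<zero>\<^bsub>M\<^esub>} = a_kernel (?F 0) M \<epsilon> \<inter> ?P 0 t" for t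
    using free_part_subset by (auto simp: a_kernel_def' simp del: free_mod_simps)
  then have ker0': "{x \<in> ?P 0 t. \<epsilon> x = \<zero>\<^bsub>M\<^esub>} = K 0 t" for t
    using K[of 0 t] by (simp add: ker0 del: free_mod_simps split: if_splits)
  have "{x \<in> ?P (Suc i) t. \<phi> i x = \<zero>\<^bsub>?F i\<^esub>} = a_kernel (?F (Suc i)) (?F i) (\<phi> i) \<inter> ?P (Suc i) t" for i t
    using free_part_subset by (auto simp: a_kernel_def' simp del: free_mod_simps)
  then have ker': "{x \<in> ?P (Suc i) t. \<phi> i x = \<zero>\<^bsub>?F i\<^esub>} = K (Suc i) t" if "i < L" for i t
    using K[of "Suc i" t] ker[OF that] by (simp del: free_mod_simps)
  have "?dim (graded_piece M G s) + r 0 = ?dim (graded_piece (?F 0) (?P 0) s)"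
    using rank_nullity_graded_piece[OF hom0 free_part_subset eq_refl[OF surj] vectorspace_free_part VM dim_free_part(1)]
    by (simp add: ker0' surj r_def)
  moreover have rank: "?dim (graded_piece (?F (Suc i)) (?P (Suc i)) s) = r i + r (Suc i)" if "i < L" for i
  proof -
    have im: "graded_piece (?F i) (\<lambda>s. \<phi> i ` ?P (Suc i) s) s = graded_piece (?F i) (K i) s"
      using that by (simp add: K_def)
    show ?thesis
      using rank_nullity_graded_piece[OF hom[OF that] free_part_subset deg[OF that] vectorspace_free_part
          vectorspace_free_part dim_free_part(1), of s]
      unfolding ker'[OF that] r_def im by (rule sym)
  qed
  moreover have "r L = 0"
    using dim_trivial_piece[OF module_free_mod] by (simp add: r_def K_def)
  ultimately have "int (?dim (graded_piece M G s)) =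
      (\<Sum>i\<le>L. (-1) ^ i * int (?dim (graded_piece (?F i) (?P i) s)))"
    using alternating_sum_telescope[of L "\<lambda>i. int (?dim (graded_piece (?F i) (?P i) s))" "\<lambda>i. int (r i)"]
    by (subst sum.atMost_shift) simp
  moreover have "fps_nth ((-1) ^ i * f) s = (-1) ^ i * fps_nth f s" for i and f :: "int fps"
    by (cases "even i") simp_all
  ultimately show "fps_nth (hilbert_series M G) s = fps_nth (\<Sum>i\<le>L. (-1) ^ i * hilbert_series (?F i) (?P i)) s"
    by (simp add: hilbert_series_def fps_sum_nth)
qed

section \<open>Pure resolutions\<close>

lemma sc_dim_bounds:
  assumes sc: "simplicial_complex n \<Delta>" and d: "sc_dim \<Delta> = int d - 1"
  shows "F \<in> \<Delta> \<Longrightarrow> card F \<le> d" "d \<le> n"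
proof -
  let ?S = "(\<lambda>F. int (card F) - 1) ` \<Delta>"
  have fin: "finite ?S" and ne: "?S \<noteq> {}"
    using simplicial_complex_finite(1)[OF sc] sc by (auto simp: simplicial_complex_def)
  have Max: "Max ?S = int d - 1"
    using d by (simp add: sc_dim_def)
  show "card F \<le> d" if "F \<in> \<Delta>"
    using Max_ge[OF fin, of "int (card F) - 1"] that by (simp add: Max)
  obtain F where "F \<in> \<Delta>" "int (card F) - 1 = int d - 1"
    using Max_in[OF fin ne] by (auto simp: Max)
  then show "d \<le> n"
    using simplicial_complex_finite(3)[OF sc] by fastforce
qed

text \<open>The value 0 that \<open>h_vector\<close> takes beyond d is the true coefficient there,
  so the product can be treated as a power series without case distinctions.\<close>

lemma h_vector_eq:
  assumes sc: "simplicial_complex n \<Delta>" and d: "sc_dim \<Delta> = int d - 1"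
  shows "h_vector TYPE('k::field) n \<Delta> j = fps_nth (monomials_fps \<Delta> * (1 - fps_X) ^ d) j"
proof -
  have "fps_nth (monomials_fps \<Delta> * (1 - fps_X) ^ d) j = 0" if "d < j"
    using simplicial_complex_finite[OF sc] sc_dim_bounds(1)[OF sc d] that
    by (intro monomials_fps_mult_power_nth) auto
  then show ?thesis
    by (simp add: h_vector_def Let_def d hilbert_series_sr_module[OF sc])
qed

text \<open>The map \<epsilon> is determined by its value on the generator, which has degree 0 and
  is therefore the class of a constant. Dividing a homogeneous representative by that constant gives
  a homogeneous preimage.\<close>

lemma augmentation_graded_surj:
  fixes \<epsilon> :: "'k::field mpol vec \<Rightarrow> 'k mpol set"
  assumes hom: "\<epsilon> \<in> LinearCombinations.module_hom (poly_ring n) (free_mod n [0]) (sr_module n \<Delta>)"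
    and deg: "\<And>s. \<epsilon> ` free_part n [0] s \<subseteq> sr_part n \<Delta> s"
    and surj: "\<epsilon> ` carrier (free_mod n [0]) = carrier (sr_module n \<Delta>)"
  shows "\<epsilon> ` free_part n [0] s = sr_part n \<Delta> s"
proof (intro equalityI deg subsetI)
  txt \<open>The generator is mapped to the class of a constant \<open>c\<close>, which is invertible unless the module is zero.\<close>
  define e :: "'k mpol vec" where "e = vec 1 (\<lambda>_. 1)"
  have e: "e \<in> free_part n [0] 0"
    by (auto simp: free_part_iff e_def lookup_one when_def split: if_splits)
  then obtain q where q: "\<epsilon> e = face_coset n \<Delta> q" "q \<in> homog_poly n 0"
    using deg[of 0] by (auto simp: sr_part_eq)
  define c where "c = Poly_Mapping.lookup q 0"
  have qc: "q = const c"
    by (rule poly_mapping_eqI)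
      (use q(2) in \<open>auto simp: homog_poly_iff const_def c_def lookup_single when_def\<close>)
  have \<epsilon>: "\<epsilon> (r \<cdot>\<^sub>v e) = face_coset n \<Delta> (r * const c)" if "r \<in> carrier (poly_ring n)" for r
    using module_hom_smult[OF hom that subsetD[OF free_part_subset e]] q(1) that
    by (simp add: face_coset_simps qc)
  fix x :: "'k mpol set" assume "x \<in> sr_part n \<Delta> s"
  then obtain p where p: "x = face_coset n \<Delta> p" "p \<in> homog_poly n s" "p \<in> carrier (poly_ring n)"
    using homog_poly_subset by (auto simp: sr_part_eq)
  have part: "r \<cdot>\<^sub>v e \<in> free_part n [0] s" if "r \<in> homog_poly n s" for r
    using that by (auto simp: free_part_iff homog_poly_iff e_def)
  show "x \<in> \<epsilon> ` free_part n [0] s"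
  proof (cases "c = 0")
    case False
    have "\<epsilon> ((const (1 / c) * p) \<cdot>\<^sub>v e) = face_coset n \<Delta> (const (1 / c) * p * const c)"
      using p(3) by (intro \<epsilon>) simp
    also have "const (1 / c) * p * const c = const (1 / c * c) * p"
      by (simp only: const_simps mult_ac)
    also have "\<dots> = p"
      using False by (simp add: const_simps)
    finally show ?thesis
      using part[OF homog_poly_const_mult[OF p(2)]] p(1) by blast
  next
    case True
    \<comment> \<open>Here \<epsilon> vanishes on the generator, hence everywhere. Being onto, it
      forces x to be the zero class, which the zero vector hits in every degree.\<close>
    have "x \<in> \<epsilon> ` carrier (free_mod n [0])"
      unfolding surj using p by simp
    then obtain v where v: "v \<in> carrier (free_mod n [0])" "x = \<epsilon> v"
      by blast
    then have "v = v $ 0 \<cdot>\<^sub>v e" "v $ 0 \<in> carrier (poly_ring n)"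
      by (auto simp: e_def)
    then have "x = face_coset n \<Delta> 0"
      using \<epsilon>[of "v $ 0"] v(2) True by (simp add: const_simps)
    also have "\<dots> = \<epsilon> (0 \<cdot>\<^sub>v e)"
      using \<epsilon>[of 0] by simp
    finally show ?thesis
      using part[of 0] by (auto simp: homog_poly_iff)
  qed
qed

text \<open>Multiplication by \<open>(1 - z)^n\<close> cancels the Hilbert series of R and leaves
  one power of z per generator. Position 0 contributes the 1; the module with index i sits in
  position \<open>i + 1\<close>, whence the sign.\<close>

lemma K_polynomial_of_pure_resolution:
  assumes sc: "simplicial_complex n \<Delta>" and res: "has_pure_free_resolution TYPE('k::field) n \<Delta> p c \<beta>"
  shows "(1 - fps_X) ^ n * monomials_fps \<Delta> = 1 + (\<Sum>i\<le>p. (-1) ^ Suc i * (of_nat (\<beta> i) * fps_X ^ c i))"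
proof -
  let ?M = "sr_module n \<Delta> :: ('k mpol, 'k mpol set) module"
  define a where "a = case_nat [0] (\<lambda>i. replicate (\<beta> i) (c i))"
  obtain \<phi> \<epsilon> where r: "graded_free_resolution n ?M (sr_part n \<Delta>) (Suc p) a \<phi> \<epsilon>"
    using res by (auto simp: has_pure_free_resolution_def minimal_graded_free_resolution_def a_def)
  have a0: "a 0 = [0]" by (simp add: a_def)
  have "\<epsilon> ` free_part n (a 0) s = sr_part n \<Delta> s" for s
    unfolding a0 by (rule augmentation_graded_surj)
      (use r in \<open>simp_all only: graded_free_resolution_def Let_def a0\<close>)
  then have "monomials_fps \<Delta> = (\<Sum>i\<le>Suc p. (-1) ^ i * ((\<Sum>j<length (a i). fps_X ^ (a i ! j)) * monomials_fps (Pow {1..n})))"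
    using hilbert_series_resolution[OF r vectorspace_sr_part]
    by (simp only: hilbert_series_sr_module[OF sc] hilbert_series_free_mod)
  then have "(1 - fps_X) ^ n * monomials_fps \<Delta> =
      (\<Sum>i\<le>Suc p. (-1) ^ i * ((\<Sum>j<length (a i). fps_X ^ (a i ! j)) * ((1 - fps_X) ^ n * monomials_fps (Pow {1..n}))))"
    by (simp only: sum_distrib_left mult_ac)
  also have "(1 - fps_X) ^ n * monomials_fps (Pow {1..n}) = 1"
    using monomials_fps_Pow[of "{1..n}"] by simp
  finally show ?thesis
    unfolding sum.atMost_Suc_shift by (simp add: a_def)
qed

theorem theorem3p1:
  fixes n d p :: nat and \<Delta> :: "nat set set" and c \<beta> :: "nat \<Rightarrow> nat"
  assumes "simplicial_complex n \<Delta>"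
    and "sc_dim \<Delta> = int d - 1"
    and "has_pure_free_resolution TYPE('k::field) n \<Delta> p c \<beta>"
  shows "\<forall>i\<le>p. int (\<beta> i) =
    (\<Sum>l = 0..c i. (-1) ^ (l + i + 1) * int ((n - d) choose l) * h_vector TYPE('k) n \<Delta> (c i - l))"
proof (intro allI impI)
  fix i assume i: "i \<le> p"
  have c0: "0 < c 0" and step: "\<And>i. i < p \<Longrightarrow> c i < c (Suc i)"
    using assms(3) by (auto simp: has_pure_free_resolution_def)
  have c_less: "c j < c k" if "j < k" "k \<le> p" for j k
    using that
  proof (induction k)
    case (Suc k)
    then show ?case
      using step[of k] by (cases "j = k") auto
  qed simp
  then have c_inj: "c j = c i \<longleftrightarrow> j = i" if "j \<le> p" for j
    using that i by (metis nat_neq_iff)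
  have "0 < c i"
    using c0 c_less[of 0 i] i by (cases "i = 0") auto
  let ?h = "monomials_fps \<Delta> * (1 - fps_X) ^ d"
  \<comment> \<open>The power splits because \<open>d \<le> n\<close>, so that \<open>n - d\<close>
    is a genuine difference.\<close>
  have pow: "(1 - fps_X :: int fps) ^ n = (1 - fps_X) ^ (n - d) * (1 - fps_X) ^ d"
    using sc_dim_bounds(2)[OF assms(1,2)] by (simp flip: power_add)
  \<comment> \<open>The sum in the claim, stripped of the sign depending on i, is a Cauchy product
    with the coefficients of \<open>(1 - z)^(n - d)\<close>.\<close>
  have "(\<Sum>l = 0..c i. (-1) ^ l * int ((n - d) choose l) * h_vector TYPE('k) n \<Delta> (c i - l)) =
      fps_nth ((1 - fps_X) ^ (n - d) * ?h) (c i)"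
    unfolding fps_mult_nth[of "(1 - fps_X) ^ (n - d)"] fps_nth_one_minus_X_power h_vector_eq[OF assms(1,2)] ..
  also have "(1 - fps_X) ^ (n - d) * ?h = (1 - fps_X) ^ n * monomials_fps \<Delta>"
    unfolding pow by (simp only: mult_ac)
  also have "fps_nth \<dots> (c i) = (\<Sum>j\<le>p. if j = i then (-1) ^ Suc i * int (\<beta> i) else 0)"
  proof -
    have "fps_nth ((-1) ^ Suc j * (of_nat (\<beta> j) * fps_X ^ c j)) (c i) =
        (if j = i then (-1) ^ Suc i * int (\<beta> i) else 0)" if "j \<le> p" for j
      using c_inj[OF that] by (cases "even j") (auto simp: fps_of_nat[symmetric] fps_X_power_nth)
    then show ?thesis
      unfolding K_polynomial_of_pure_resolution[OF assms(1,3)]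
      using \<open>0 < c i\<close> by (simp add: fps_sum_nth)
  qed
  also have "\<dots> = (-1) ^ Suc i * int (\<beta> i)"
    using i by simp
  \<comment> \<open>The sign is its own inverse, so it moves to the other side unchanged.\<close>
  finally have "(-1) ^ Suc i * (\<Sum>l = 0..c i. (-1) ^ l * int ((n - d) choose l) * h_vector TYPE('k) n \<Delta> (c i - l)) =
      int (\<beta> i)"
    by (cases "even i") auto
  then show "int (\<beta> i) =
      (\<Sum>l = 0..c i. (-1) ^ (l + i + 1) * int ((n - d) choose l) * h_vector TYPE('k) n \<Delta> (c i - l))"
    by (simp add: sum_distrib_left power_add mult_ac)
qed

end
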